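(* (Tarski–Vaught test.) Let $M$ be a subset of the home sort of $\mathcal{U}$ and let $\mathcal{H}$ be a set of positive formulas which is p-dense modulo $T$. Then the following are equivalent: (1) $M$ is a p-model; (2) for every formula $\psi(x)\in\mathcal{H}(M)$: if $\mathcal{U}\models\exists x\,\psi(x)$, then for every weakening $\psi'>\psi$ there is $a\in M^{|x|}$ with $\mathcal{U}\models\psi'(a)$; (3) for every formula $\psi(x)\in\mathcal{H}(M)$: if $\mathcal{U}\models\exists x\,\neg\psi(x)$, then there is $a\in M^{|x|}$ with $\mathcal{U}\models\neg\psi(a)$. If instead $\mathcal{H}$ is a set of continuous formulas which is c-dense modulo $T$, then (2) and (3) are equivalent to each other and to (1$'$) $\mathrm{Ccl}(M)$ is a c-model; and moreover, if in addition $M$ is closed under the interpretations in $\mathcal{U}$ of the function symbols of sort ${\sf H}^n\to{\sf H}$ (i.e. $M$ is a substructure), then (1$'$), (2) and (3) are also equivalent to (1$''$) $M$ is a c-model.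
   Context: Fix a compact Hausdorff space $S$. $\mathcal{L}_{\sf S}$ is the first-order language having a relation symbol for every compact $C\subseteq S^n$ ($n\ge 1$) and a function symbol for every continuous $f:S^n\to S$ (in particular a constant for each point of $S$); $S$ is an $\mathcal{L}_{\sf S}$-structure in the obvious way. $\mathcal{L}_{\sf H}$ is a fixed first-order language. $\mathcal{L}$ is a two-sorted language, with sorts ${\sf H}$ (home sort) and ${\sf S}$, expanding $\mathcal{L}_{\sf H}$ on ${\sf H}$ and $\mathcal{L}_{\sf S}$ on ${\sf S}$, possibly with further function symbols of sorts ${\sf H}^n\times{\sf S}^m\to{\sf S}$, and with a relation symbol $r_\varphi(x)$ for every $\mathcal{L}_{\sf H}$-formula $\varphi(x)$. An $\mathcal{L}$-structure is a two-sorted structure of signature $\mathcal{L}$ satisfying $r_\varphi(x)\leftrightarrow\varphi(x)$ for all $\varphi\in\mathcal{L}_{\sf H}$, in which every function symbol $f$ of sort ${\sf H}^n\times{\sf S}^m\to{\sf S}$ is equicontinuous: for every compact neighbourhood $\varepsilon$ of the diagonal of $S^2$ there is a compact neighbourhood $\delta$ of the diagonal of $(S^m)^2$ such that $\forall x\,\forall\eta,\eta'\,(\langle\eta,\eta'\rangle\in\delta\to\langle f(x,\eta),f(x,\eta')\rangle\in\varepsilon)$ holds. A standard structure is an $\mathcal{L}$-structure $\langle M,S\rangle$ whose ${\sf S}$-sort is $S$ itself with its canonical interpretation of $\mathcal{L}_{\sf S}$; it is identified with $M$. Up to equivalence, atomic formulas are $r_\varphi(x)$ and $\tau(x;\eta)\in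 C$ with $\tau$ an $n$-tuple of terms of sort ${\sf S}$ and $C\subseteq S^n$ compact. A formula is positive if built from atomic formulas using only $\wedge,\vee$ and $\forall,\exists$ of both sorts; it is continuous if it is positive and all its atomic subformulas are of the form $\tau\in C$. For a set of formulas $\mathcal{H}$ and a set $A$, $\mathcal{H}(A)$ is the set of formulas $\psi(x,b)$ with $\psi(x,z)\in\mathcal{H}$ and $b$ a tuple from $A$ (and from $S$). Weakenings: for compact $C,C'\subseteq S^n$ write $C'>C$ if $C'$ is a neighbourhood of $C$; for positive formulas write $\psi'>\psi$ if $\psi'$ is obtained from $\psi$ by replacing each atomic subformula $\tau\in C$ by $\tau\in C'$ for some $C'>C$ (if there is none, $\psi>\psi$). $\mathcal{U}$ is a fixed large standard structure that is p-saturated: it realizes every set of positive formulas with fewer than $|\mathcal{U}|$ parameters from $\mathcal{U}$ that is finitely consistent in $\mathcal{U}$. $T$ is the set of positive sentences true in $\mathcal{U}$. A set $\mathcal{H}$ of formulas is p-dense (resp. c-dense) modulo $T$ if for every positive (resp. continuous) formula $\varphi(x)$ and every $\varphi'>\varphi$ there is $\psi(x)\in\mathcal{H}$ with $\varphi\to\psi\to\varphi'$ in every standard model of $T$. A p-model (resp. c-model) is a subset $M$ of the home sort of $\mathcal{U}$ closed under the function symbols of sort ${\sf H}^n\to{\sf H}$ (so $\langle M,S\rangle$ is a standard substructure of $\mathcal{U}$) such that $M\models\varphi(a)$ implies $\mathcal{U}\models\varphi(a)$ for every positive (resp. continuous) formula $\varphi(x)$ and every tuple $a$ from $M$ (and $S$).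 Cauchy completion: for a tuple $\tau=\langle\tau_1(x,z),\dots,\tau_n(x,z)\rangle$ of terms of sort ${\sf H}^{1+|z|}\to{\sf S}$ and a compact neighbourhood $D$ of the diagonal of $S^2$, $x\sim_{\tau,D}y$ is the formula $\bigwedge_{i=1}^n\forall z\,\langle\tau_i(x,z),\tau_i(y,z)\rangle\in D$; for $a\in\mathcal{U}$, $a\sim' x$ is the set of all formulas $a\sim_{\tau,D}x$. $\mathrm{Ccl}(M)$ is the set of $a\in\mathcal{U}$ such that every finite conjunction of formulas of $a\sim'x$ is satisfied by some element of $M$. *)

theory Defs
  imports "HOL-Analysis.Analysis" "HOL-Library.Equipollence"
begin

text \<open>
  The compact Hausdorff space \<open>S\<close> is a type \<open>'s :: t2_space\<close>; compactness of \<open>UNIV\<close> is a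
  hypothesis of the theorem.  The power \<open>S\<^sup>n\<close> is the product topology on the extensional functions
  on \<open>{..<n}\<close>, so that all \<open>n\<close> live in one type.
\<close>

abbreviation spow :: "nat \<Rightarrow> (nat \<Rightarrow> 's::topological_space) topology" where
  "spow n \<equiv> product_topology (\<lambda>_. euclidean) {..<n}"

definition tuple :: "'s list \<Rightarrow> (nat \<Rightarrow> 's)" where
  "tuple ss = (\<lambda>i\<in>{..<length ss}. ss ! i)"

definition compact_nbhd :: "'a topology \<Rightarrow> 'a set \<Rightarrow> 'a set \<Rightarrow> bool" where
  "compact_nbhd X K C \<longleftrightarrow> compactin X K \<and> C \<subseteq> X interior_of K"


section \<open>Syntax\<close>

text \<open>
  The symbols that are not already determined by \<open>S\<close>: function and relation symbols of the home
  language, and function symbols of sort \<open>H\<^sup>n \<times> S\<^sup>m \<rightarrow> S\<close>.  The elements of \<open>'f\<close>, \<open>'r\<close>, \<open>'g\<close> mapped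
  to \<open>None\<close> are not symbols of the language, so each set of symbols may be empty.
\<close>

record ('f, 'r, 'g) lang =
  hfun_arity :: "'f \<Rightarrow> nat option"
  hrel_arity :: "'r \<Rightarrow> nat option"
  sfun_arity :: "'g \<Rightarrow> (nat \<times> nat) option"

datatype 'f hterm = HVar nat | HApp 'f "'f hterm list"

datatype ('f, 'r) hform =
    HEq "'f hterm" "'f hterm"
  | HRel 'r "'f hterm list"
  | HNeg "('f, 'r) hform"
  | HConj "('f, 'r) hform" "('f, 'r) hform"
  | HEx nat "('f, 'r) hform"

text \<open>
  \<open>SCont F ts\<close> applies the symbol of the continuous function \<open>F : S\<^sup>n \<rightarrow> S\<close>, \<open>n = length ts\<close>; for
  \<open>n = 0\<close> this is a constant for a point of \<open>S\<close>.
\<close>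

datatype ('f, 'g, 's) sterm =
    SVar nat
  | SCont "(nat \<Rightarrow> 's) \<Rightarrow> 's" "('f, 'g, 's) sterm list"
  | SApp 'g "'f hterm list" "('f, 'g, 's) sterm list"

text \<open>
  \<open>RH \<phi>\<close> is the atomic formula \<open>r\<^sub>\<phi>(x)\<close>, with \<open>x\<close> the free variables of \<open>\<phi>\<close>; applying \<open>r\<^sub>\<phi>\<close> to other
  variables or to terms is the same as changing \<open>\<phi>\<close>.  \<open>SIn ts C\<close> is \<open>\<tau> \<in> C\<close>.  The two sorts have
  separate supplies of variables.
\<close>

datatype ('f, 'r, 'g, 's) form =
    RH "('f, 'r) hform"
  | SIn "('f, 'g, 's) sterm list" "(nat \<Rightarrow> 's) set"
  | Neg "('f, 'r, 'g, 's) form"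
  | Conj "('f, 'r, 'g, 's) form" "('f, 'r, 'g, 's) form"
  | Disj "('f, 'r, 'g, 's) form" "('f, 'r, 'g, 's) form"
  | AllH nat "('f, 'r, 'g, 's) form"
  | ExH nat "('f, 'r, 'g, 's) form"
  | AllS nat "('f, 'r, 'g, 's) form"
  | ExS nat "('f, 'r, 'g, 's) form"

fun wf_hterm :: "('f, 'r, 'g) lang \<Rightarrow> 'f hterm \<Rightarrow> bool" where
  "wf_hterm L (HVar i) \<longleftrightarrow> True"
| "wf_hterm L (HApp f ts) \<longleftrightarrow>
     hfun_arity L f = Some (length ts) \<and> (\<forall>t\<in>set ts. wf_hterm L t)"

fun wf_hform :: "('f, 'r, 'g) lang \<Rightarrow> ('f, 'r) hform \<Rightarrow> bool" where
  "wf_hform L (HEq t u) \<longleftrightarrow> wf_hterm L t \<and> wf_hterm L u"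
| "wf_hform L (HRel R ts) \<longleftrightarrow>
     hrel_arity L R = Some (length ts) \<and> (\<forall>t\<in>set ts. wf_hterm L t)"
| "wf_hform L (HNeg p) \<longleftrightarrow> wf_hform L p"
| "wf_hform L (HConj p q) \<longleftrightarrow> wf_hform L p \<and> wf_hform L q"
| "wf_hform L (HEx i p) \<longleftrightarrow> wf_hform L p"

fun wf_sterm :: "('f, 'r, 'g) lang \<Rightarrow> ('f, 'g, 's::topological_space) sterm \<Rightarrow> bool" where
  "wf_sterm L (SVar i) \<longleftrightarrow> True"
| "wf_sterm L (SCont F ts) \<longleftrightarrow>
     continuous_map (spow (length ts)) euclidean F \<and> (\<forall>t\<in>set ts. wf_sterm L t)"
| "wf_sterm L (SApp g us ts) \<longleftrightarrow>
     sfun_arity L g = Some (length us, length ts) \<and>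
     (\<forall>u\<in>set us. wf_hterm L u) \<and> (\<forall>t\<in>set ts. wf_sterm L t)"

fun wf_form :: "('f, 'r, 'g) lang \<Rightarrow> ('f, 'r, 'g, 's::topological_space) form \<Rightarrow> bool" where
  "wf_form L (RH p) \<longleftrightarrow> wf_hform L p"
| "wf_form L (SIn ts C) \<longleftrightarrow>
     ts \<noteq> [] \<and> (\<forall>t\<in>set ts. wf_sterm L t) \<and> compactin (spow (length ts)) C"
| "wf_form L (Neg p) \<longleftrightarrow> wf_form L p"
| "wf_form L (Conj p q) \<longleftrightarrow> wf_form L p \<and> wf_form L q"
| "wf_form L (Disj p q) \<longleftrightarrow> wf_form L p \<and> wf_form L q"
| "wf_form L (AllH i p) \<longleftrightarrow> wf_form L p"
| "wf_form L (ExH i p) \<longleftrightarrow> wf_form L p"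
| "wf_form L (AllS i p) \<longleftrightarrow> wf_form L p"
| "wf_form L (ExS i p) \<longleftrightarrow> wf_form L p"

fun hvars_hterm :: "'f hterm \<Rightarrow> nat set" where
  "hvars_hterm (HVar i) = {i}"
| "hvars_hterm (HApp f ts) = (\<Union>t\<in>set ts. hvars_hterm t)"

fun hvars_hform :: "('f, 'r) hform \<Rightarrow> nat set" where
  "hvars_hform (HEq t u) = hvars_hterm t \<union> hvars_hterm u"
| "hvars_hform (HRel R ts) = (\<Union>t\<in>set ts. hvars_hterm t)"
| "hvars_hform (HNeg p) = hvars_hform p"
| "hvars_hform (HConj p q) = hvars_hform p \<union> hvars_hform q"
| "hvars_hform (HEx i p) = hvars_hform p - {i}"

fun hvars_sterm :: "('f, 'g, 's) sterm \<Rightarrow> nat set" where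
  "hvars_sterm (SVar i) = {}"
| "hvars_sterm (SCont F ts) = (\<Union>t\<in>set ts. hvars_sterm t)"
| "hvars_sterm (SApp g us ts) = (\<Union>u\<in>set us. hvars_hterm u) \<union> (\<Union>t\<in>set ts. hvars_sterm t)"

fun svars_sterm :: "('f, 'g, 's) sterm \<Rightarrow> nat set" where
  "svars_sterm (SVar i) = {i}"
| "svars_sterm (SCont F ts) = (\<Union>t\<in>set ts. svars_sterm t)"
| "svars_sterm (SApp g us ts) = (\<Union>t\<in>set ts. svars_sterm t)"

fun hvars :: "('f, 'r, 'g, 's) form \<Rightarrow> nat set" where
  "hvars (RH p) = hvars_hform p"
| "hvars (SIn ts C) = (\<Union>t\<in>set ts. hvars_sterm t)"
| "hvars (Neg p) = hvars p"
| "hvars (Conj p q) = hvars p \<union> hvars q"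
| "hvars (Disj p q) = hvars p \<union> hvars q"
| "hvars (AllH i p) = hvars p - {i}"
| "hvars (ExH i p) = hvars p - {i}"
| "hvars (AllS i p) = hvars p"
| "hvars (ExS i p) = hvars p"

fun svars :: "('f, 'r, 'g, 's) form \<Rightarrow> nat set" where
  "svars (RH p) = {}"
| "svars (SIn ts C) = (\<Union>t\<in>set ts. svars_sterm t)"
| "svars (Neg p) = svars p"
| "svars (Conj p q) = svars p \<union> svars q"
| "svars (Disj p q) = svars p \<union> svars q"
| "svars (AllH i p) = svars p"
| "svars (ExH i p) = svars p"
| "svars (AllS i p) = svars p - {i}"
| "svars (ExS i p) = svars p - {i}"

fun positive :: "('f, 'r, 'g, 's) form \<Rightarrow> bool" where
  "positive (RH p) \<longleftrightarrow> True"
| "positive (SIn ts C) \<longleftrightarrow> True"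
| "positive (Neg p) \<longleftrightarrow> False"
| "positive (Conj p q) \<longleftrightarrow> positive p \<and> positive q"
| "positive (Disj p q) \<longleftrightarrow> positive p \<and> positive q"
| "positive (AllH i p) \<longleftrightarrow> positive p"
| "positive (ExH i p) \<longleftrightarrow> positive p"
| "positive (AllS i p) \<longleftrightarrow> positive p"
| "positive (ExS i p) \<longleftrightarrow> positive p"

fun no_home_atoms :: "('f, 'r, 'g, 's) form \<Rightarrow> bool" where
  "no_home_atoms (RH p) \<longleftrightarrow> False"
| "no_home_atoms (SIn ts C) \<longleftrightarrow> True"
| "no_home_atoms (Neg p) \<longleftrightarrow> no_home_atoms p"
| "no_home_atoms (Conj p q) \<longleftrightarrow> no_home_atoms p \<and> no_home_atoms q"
| "no_home_atoms (Disj p q) \<longleftrightarrow> no_home_atoms p \<and> no_home_atoms q"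
| "no_home_atoms (AllH i p) \<longleftrightarrow> no_home_atoms p"
| "no_home_atoms (ExH i p) \<longleftrightarrow> no_home_atoms p"
| "no_home_atoms (AllS i p) \<longleftrightarrow> no_home_atoms p"
| "no_home_atoms (ExS i p) \<longleftrightarrow> no_home_atoms p"

definition positive_forms :: "('f, 'r, 'g) lang \<Rightarrow> ('f, 'r, 'g, 's::topological_space) form set" where
  "positive_forms L = {\<phi>. wf_form L \<phi> \<and> positive \<phi>}"

definition continuous_forms :: "('f, 'r, 'g) lang \<Rightarrow> ('f, 'r, 'g, 's::topological_space) form set" where
  "continuous_forms L = {\<phi>. wf_form L \<phi> \<and> positive \<phi> \<and> no_home_atoms \<phi>}"

text \<open>\<open>weakening \<phi> \<phi>'\<close> is \<open>\<phi>' > \<phi>\<close>.\<close>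

inductive weakening ::
  "('f, 'r, 'g, 's::topological_space) form \<Rightarrow> ('f, 'r, 'g, 's) form \<Rightarrow> bool" where
  RH: "weakening (RH p) (RH p)"
| SIn: "compact_nbhd (spow (length ts)) C' C \<Longrightarrow> weakening (SIn ts C) (SIn ts C')"
| Conj: "weakening p p' \<Longrightarrow> weakening q q' \<Longrightarrow> weakening (Conj p q) (Conj p' q')"
| Disj: "weakening p p' \<Longrightarrow> weakening q q' \<Longrightarrow> weakening (Disj p q) (Disj p' q')"
| AllH: "weakening p p' \<Longrightarrow> weakening (AllH i p) (AllH i p')"
| ExH: "weakening p p' \<Longrightarrow> weakening (ExH i p) (ExH i p')"
| AllS: "weakening p p' \<Longrightarrow> weakening (AllS i p) (AllS i p')"
| ExS: "weakening p p' \<Longrightarrow> weakening (ExS i p) (ExS i p')"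


section \<open>Standard structures\<close>

text \<open>
  Only the data not determined by \<open>S\<close> are recorded.  The symbols \<open>r\<^sub>\<phi>\<close> need no interpretation of
  their own, since \<open>r\<^sub>\<phi> \<leftrightarrow> \<phi>\<close> holds by definition in every structure.
\<close>

record ('f, 'r, 'g, 's, 'u) struct =
  home :: "'u set"
  hfun :: "'f \<Rightarrow> 'u list \<Rightarrow> 'u"
  hrel :: "'r \<Rightarrow> 'u list \<Rightarrow> bool"
  sfun :: "'g \<Rightarrow> 'u list \<Rightarrow> (nat \<Rightarrow> 's) \<Rightarrow> 's"

definition hclosed ::
  "('f, 'r, 'g) lang \<Rightarrow> ('f, 'r, 'g, 's, 'u) struct \<Rightarrow> 'u set \<Rightarrow> bool" where
  "hclosed L N A \<longleftrightarrow>
     (\<forall>f n xs. hfun_arity L f = Some n \<and> length xs = n \<and> set xs \<subseteq> A \<longrightarrow> hfun N f xs \<in> A)"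

definition equicontinuous ::
  "'u set \<Rightarrow> nat \<Rightarrow> nat \<Rightarrow> ('u list \<Rightarrow> (nat \<Rightarrow> 's::topological_space) \<Rightarrow> 's) \<Rightarrow> bool" where
  "equicontinuous A n m f \<longleftrightarrow>
     (\<forall>\<epsilon> :: ('s \<times> 's) set. compact_nbhd euclidean \<epsilon> Id \<longrightarrow>
       (\<exists>\<delta>. compact_nbhd (prod_topology (spow m) (spow m)) \<delta> (Id_on (topspace (spow m))) \<and>
         (\<forall>xs \<eta> \<eta>'. length xs = n \<and> set xs \<subseteq> A \<and> (\<eta>, \<eta>') \<in> \<delta> \<longrightarrow> (f xs \<eta>, f xs \<eta>') \<in> \<epsilon>)))"

definition standard_structure ::
  "('f, 'r, 'g) lang \<Rightarrow> ('f, 'r, 'g, 's::topological_space, 'u) struct \<Rightarrow> bool" where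
  "standard_structure L N \<longleftrightarrow>
     home N \<noteq> {} \<and> hclosed L N (home N) \<and>
     (\<forall>g n m. sfun_arity L g = Some (n, m) \<longrightarrow> equicontinuous (home N) n m (sfun N g))"

primrec heval :: "('f, 'r, 'g, 's, 'u) struct \<Rightarrow> (nat \<Rightarrow> 'u) \<Rightarrow> 'f hterm \<Rightarrow> 'u" where
  "heval N v (HVar i) = v i"
| "heval N v (HApp f ts) = hfun N f (map (heval N v) ts)"

primrec hsat :: "('f, 'r, 'g, 's, 'u) struct \<Rightarrow> (nat \<Rightarrow> 'u) \<Rightarrow> ('f, 'r) hform \<Rightarrow> bool" where
  "hsat N v (HEq t u) \<longleftrightarrow> heval N v t = heval N v u"
| "hsat N v (HRel R ts) \<longleftrightarrow> hrel N R (map (heval N v) ts)"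
| "hsat N v (HNeg p) \<longleftrightarrow> \<not> hsat N v p"
| "hsat N v (HConj p q) \<longleftrightarrow> hsat N v p \<and> hsat N v q"
| "hsat N v (HEx i p) \<longleftrightarrow> (\<exists>a\<in>home N. hsat N (v(i := a)) p)"

primrec seval ::
  "('f, 'r, 'g, 's, 'u) struct \<Rightarrow> (nat \<Rightarrow> 'u) \<Rightarrow> (nat \<Rightarrow> 's) \<Rightarrow> ('f, 'g, 's) sterm \<Rightarrow> 's" where
  "seval N v w (SVar i) = w i"
| "seval N v w (SCont F ts) = F (tuple (map (seval N v w) ts))"
| "seval N v w (SApp g us ts) =
     sfun N g (map (heval N v) us) (tuple (map (seval N v w) ts))"

primrec sat ::
  "('f, 'r, 'g, 's, 'u) struct \<Rightarrow> (nat \<Rightarrow> 'u) \<Rightarrow> (nat \<Rightarrow> 's) \<Rightarrow> ('f, 'r, 'g, 's) form \<Rightarrow> bool" where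
  "sat N v w (RH p) \<longleftrightarrow> hsat N v p"
| "sat N v w (SIn ts C) \<longleftrightarrow> tuple (map (seval N v w) ts) \<in> C"
| "sat N v w (Neg p) \<longleftrightarrow> \<not> sat N v w p"
| "sat N v w (Conj p q) \<longleftrightarrow> sat N v w p \<and> sat N v w q"
| "sat N v w (Disj p q) \<longleftrightarrow> sat N v w p \<or> sat N v w q"
| "sat N v w (AllH i p) \<longleftrightarrow> (\<forall>a\<in>home N. sat N (v(i := a)) w p)"
| "sat N v w (ExH i p) \<longleftrightarrow> (\<exists>a\<in>home N. sat N (v(i := a)) w p)"
| "sat N v w (AllS i p) \<longleftrightarrow> (\<forall>s. sat N v (w(i := s)) p)"
| "sat N v w (ExS i p) \<longleftrightarrow> (\<exists>s. sat N v (w(i := s)) p)"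


section \<open>Saturation, theory, density, models\<close>

text \<open>
  A formula with parameters is a pair \<open>(\<psi>, e)\<close>, where the partial map \<open>e\<close> assigns parameters to some
  of the home variables.  Parameters from \<open>S\<close> are constants of the language.
\<close>

definition plug :: "(nat \<Rightarrow> 'u) \<Rightarrow> (nat \<rightharpoonup> 'u) \<Rightarrow> (nat \<Rightarrow> 'u)" where
  "plug v e = (\<lambda>i. case e i of None \<Rightarrow> v i | Some b \<Rightarrow> b)"

definition realized_in ::
  "('f, 'r, 'g, 's, 'u) struct \<Rightarrow> (('f, 'r, 'g, 's) form \<times> (nat \<rightharpoonup> 'u)) set \<Rightarrow> bool" where
  "realized_in N P \<longleftrightarrow>
     (\<exists>v w. range v \<subseteq> home N \<and> (\<forall>(\<psi>, e)\<in>P. sat N (plug v e) w \<psi>))"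

definition p_saturated ::
  "('f, 'r, 'g) lang \<Rightarrow> ('f, 'r, 'g, 's::topological_space, 'u) struct \<Rightarrow> bool" where
  "p_saturated L N \<longleftrightarrow>
     (\<forall>P. (\<forall>(\<psi>, e)\<in>P. \<psi> \<in> positive_forms L \<and> ran e \<subseteq> home N) \<and>
          (\<Union>(\<psi>, e)\<in>P. ran e) \<prec> home N \<and>
          (\<forall>Q. finite Q \<and> Q \<subseteq> P \<longrightarrow> realized_in N Q) \<longrightarrow>
        realized_in N P)"

definition valid_in :: "('f, 'r, 'g, 's, 'u) struct \<Rightarrow> ('f, 'r, 'g, 's) form \<Rightarrow> bool" where
  "valid_in N \<phi> \<longleftrightarrow> (\<forall>v w. range v \<subseteq> home N \<longrightarrow> sat N v w \<phi>)"

definition positive_theory ::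
  "('f, 'r, 'g) lang \<Rightarrow> ('f, 'r, 'g, 's::topological_space, 'u) struct \<Rightarrow> ('f, 'r, 'g, 's) form set" where
  "positive_theory L N = {\<phi>\<in>positive_forms L. hvars \<phi> = {} \<and> svars \<phi> = {} \<and> valid_in N \<phi>}"

text \<open>
  The standard models of \<open>T\<close> have their home sorts inside the type \<open>'u\<close> (the argument \<open>TYPE('u)\<close>),
  which serves as the universe of home elements.  By downward Loewenheim-Skolem (\<open>S\<close> is named by
  constants), if \<open>'u\<close> has at least as many elements as there are formulas of the language then a
  formula of the language true in all of these is true in all standard models of \<open>T\<close>.
\<close>

definition dense_modulo ::
  "'u itself \<Rightarrow> ('f, 'r, 'g) lang \<Rightarrow> ('f, 'r, 'g, 's::topological_space) form set \<Rightarrow>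
   ('f, 'r, 'g, 's) form set \<Rightarrow> ('f, 'r, 'g, 's) form set \<Rightarrow> bool" where
  "dense_modulo _ L T \<F> \<H> \<longleftrightarrow>
     (\<forall>\<phi>\<in>\<F>. \<forall>\<phi>'. svars \<phi> = {} \<and> weakening \<phi> \<phi>' \<longrightarrow>
       (\<exists>\<psi>\<in>\<H>. hvars \<psi> \<subseteq> hvars \<phi> \<and> svars \<psi> = {} \<and>
         (\<forall>N :: ('f, 'r, 'g, 's, 'u) struct. standard_structure L N \<and> (\<forall>\<theta>\<in>T. valid_in N \<theta>) \<longrightarrow>
           (\<forall>v w. range v \<subseteq> home N \<longrightarrow>
             (sat N v w \<phi> \<longrightarrow> sat N v w \<psi>) \<and> (sat N v w \<psi> \<longrightarrow> sat N v w \<phi>')))))"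

definition p_dense where
  "p_dense (ty :: 'u itself) L T \<H> \<longleftrightarrow> dense_modulo ty L T (positive_forms L) \<H>"

definition c_dense where
  "c_dense (ty :: 'u itself) L T \<H> \<longleftrightarrow> dense_modulo ty L T (continuous_forms L) \<H>"

text \<open>
  Only the free variables are required to take values in \<open>M\<close>, so that sentences are covered also
  when \<open>M\<close> is empty.
\<close>

definition submodel ::
  "('f, 'r, 'g) lang \<Rightarrow> ('f, 'r, 'g, 's, 'u) struct \<Rightarrow> ('f, 'r, 'g, 's) form set \<Rightarrow> 'u set \<Rightarrow> bool" where
  "submodel L U \<F> M \<longleftrightarrow>
     M \<subseteq> home U \<and> hclosed L U M \<and>
     (\<forall>\<phi>\<in>\<F>. \<forall>v w. v ` hvars \<phi> \<subseteq> M \<longrightarrow> sat (U\<lparr>home := M\<rparr>) v w \<phi> \<longrightarrow> sat U v w \<phi>)"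

definition p_model where
  "p_model L U M \<longleftrightarrow> submodel L U (positive_forms L) M"

definition c_model where
  "c_model L U M \<longleftrightarrow> submodel L U (continuous_forms L) M"


section \<open>Cauchy completion\<close>

text \<open>
  \<open>a \<sim>\<^bsub>\<tau>,D\<^esub> b\<close> in \<open>U\<close>.  The variable \<open>x\<close> of \<open>\<tau>(x,z)\<close> is the home variable \<open>0\<close>, and \<open>z\<close> consists of
  the other home variables.
\<close>

definition sim ::
  "('f, 'r, 'g, 's, 'u) struct \<Rightarrow> ('f, 'g, 's) sterm list \<Rightarrow> ('s \<times> 's) set \<Rightarrow> 'u \<Rightarrow> 'u \<Rightarrow> bool" where
  "sim U \<tau> D a b \<longleftrightarrow>
     (\<forall>t\<in>set \<tau>. \<forall>v w. range v \<subseteq> home U \<longrightarrow>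
        (seval U (v(0 := a)) w t, seval U (v(0 := b)) w t) \<in> D)"

definition sim_indices ::
  "('f, 'r, 'g) lang \<Rightarrow> (('f, 'g, 's::topological_space) sterm list \<times> ('s \<times> 's) set) set" where
  "sim_indices L =
     {(\<tau>, D). (\<forall>t\<in>set \<tau>. wf_sterm L t \<and> svars_sterm t = {}) \<and> compact_nbhd euclidean D Id}"

definition Ccl ::
  "('f, 'r, 'g) lang \<Rightarrow> ('f, 'r, 'g, 's::topological_space, 'u) struct \<Rightarrow> 'u set \<Rightarrow> 'u set" where
  "Ccl L U M =
     {a\<in>home U. \<forall>I. finite I \<and> I \<subseteq> sim_indices L \<longrightarrow> (\<exists>b\<in>M. \<forall>(\<tau>, D)\<in>I. sim U \<tau> D a b)}"


section \<open>The two Tarski-Vaught conditions\<close>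

text \<open>
  A formula \<open>\<psi>(x) \<in> \<H>(M)\<close> is given by \<open>\<psi> \<in> \<H>\<close>, the finite set \<open>X\<close> of the variables \<open>x\<close>, and
  valuations \<open>v\<close>, \<open>w\<close> supplying the parameters from \<open>M\<close> and from \<open>S\<close> for all other free variables.
\<close>

definition tv_weakening ::
  "('f, 'r, 'g, 's::topological_space, 'u) struct \<Rightarrow> ('f, 'r, 'g, 's) form set \<Rightarrow> 'u set \<Rightarrow> bool" where
  "tv_weakening U \<H> M \<longleftrightarrow>
     (\<forall>\<psi>\<in>\<H>. \<forall>X v w. finite X \<and> v ` (hvars \<psi> - X) \<subseteq> M \<longrightarrow>
        (\<exists>a. a ` X \<subseteq> home U \<and> sat U (override_on v a X) w \<psi>) \<longrightarrow>
        (\<forall>\<psi>'. weakening \<psi> \<psi>' \<longrightarrow> (\<exists>a. a ` X \<subseteq> M \<and> sat U (override_on v a X) w \<psi>')))"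

definition tv_negation ::
  "('f, 'r, 'g, 's, 'u) struct \<Rightarrow> ('f, 'r, 'g, 's) form set \<Rightarrow> 'u set \<Rightarrow> bool" where
  "tv_negation U \<H> M \<longleftrightarrow>
     (\<forall>\<psi>\<in>\<H>. \<forall>X v w. finite X \<and> v ` (hvars \<psi> - X) \<subseteq> M \<longrightarrow>
        (\<exists>a. a ` X \<subseteq> home U \<and> sat U (override_on v a X) w (Neg \<psi>)) \<longrightarrow>
        (\<exists>a. a ` X \<subseteq> M \<and> sat U (override_on v a X) w (Neg \<psi>)))"

end

theory Submission
  imports Defs
begin

text \<open>
  Negation is not available among positive formulas, but \<open>p' > p\<close> always yields positive formulas
  \<open>q' > q\<close> with \<open>\<not> p' \<rightarrow> q\<close> and \<open>q'\<close> inconsistent with \<open>p\<close>.  Saturation shows that a positive formula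
  is equivalent in \<open>U\<close> to the set of its weakenings, and therefore that the two Tarski--Vaught
  conditions for a dense \<open>\<H>\<close> are equivalent to each other and to those for all positive (continuous)
  formulas.  For the latter class the comparison with submodels is a strong-negation version of the
  classical test.

  For the Cauchy completion, two elements that satisfy all relations \<open>\<sim>\<^bsub>\<tau>,D\<^esub>\<close> give every term the
  same value, since \<open>S\<close>-variables can be replaced by constants; hence they satisfy the same continuous
  formulas.  By saturation, for \<open>p' > p\<close> finitely many relations \<open>\<sim>\<^bsub>\<tau>,D\<^esub>\<close> already transfer \<open>p\<close> to
  \<open>p'\<close>, so the Tarski--Vaught conditions for \<open>M\<close> and for \<open>Ccl M\<close> agree.
\<close>

section \<open>Compact neighbourhoods\<close>

text \<open>Working without negation has a price: each use of density, of a strong negation or of a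
  finite set of relations \<open>sim\<close> turns a formula into one of its weakenings.
  Interpolated weakenings provide the room to chain several such steps, and this is why intermediate
  formulas such as \<open>p1\<close>, \<open>p2\<close>, \<open>q1\<close>, \<open>r1\<close> occur
  throughout. Every application of saturation involves finitely many home parameters, namely values
  of free variables, because points of S are available as constants; with an infinite home sort the
  cardinality bound in saturation is then automatic. The two classes of formulas differ at closure
  under home functions. A positive formula can say y = f(x), which forces f(x) into M. A continuous
  formula can only say that y and f(x) give S-valued terms the same or close values, which puts f(x)
  into Ccl M but not into M. So the continuous version is about Ccl M, and about M itself only if M
  is a substructure.\<close>

lemma compact_nbhd_disjoint_exists:
  assumes "compact_space X" "Hausdorff_space X" "compactin X A" "compactin X B" "A \<inter> B = {}"
  shows "\<exists>K. compact_nbhd X K A \<and> K \<inter> B = {}"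
proof -
  have "normal_space X"
    using assms by (simp add: compact_Hausdorff_or_regular_imp_normal_space)
  moreover have "closedin X A" "closedin X B"
    using assms by (auto simp: compactin_imp_closedin)
  ultimately obtain V W where VW: "openin X V" "openin X W" "A \<subseteq> V" "B \<subseteq> W" "disjnt V W"
    using assms(5) unfolding normal_space_def disjnt_def by metis
  \<comment> \<open>The complement of W is the required neighbourhood: it is closed, hence compact,
    contains the open set V and misses B.\<close>
  have "compactin X (topspace X - W)"
    using assms(1) VW(2) by (intro closedin_compact_space) auto
  moreover have "V \<subseteq> topspace X - W"
    using VW openin_subset by (fastforce simp: disjnt_def)
  then have "A \<subseteq> X interior_of (topspace X - W)"
    using VW by (meson interior_of_maximal order_trans)
  ultimately show ?thesis
    using VW unfolding compact_nbhd_def by blast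
qed

text \<open>Topological core of the strong negation of an atom. The complement of C' need not be
  closed, so B is taken to be the complement of the interior of C'; it still misses C and can
  therefore be fattened away from C.\<close>

lemma compact_nbhd_separation:
  assumes X: "compact_space X" "Hausdorff_space X" and C: "compactin X C" "compact_nbhd X C' C"
  obtains B B' where "compact_nbhd X B' B" "compactin X B" "topspace X - C' \<subseteq> B"
    "B' \<inter> C = {}"
proof -
  let ?B = "topspace X - X interior_of C'"
  have "compactin X ?B"
    using X by (intro closedin_compact_space) auto
  moreover have "?B \<inter> C = {}"
    using C by (auto simp: compact_nbhd_def)
  ultimately obtain K where "compact_nbhd X K ?B" "K \<inter> C = {}"
    using compact_nbhd_disjoint_exists[OF X _ C(1)] by blast
  moreover have "topspace X - C' \<subseteq> ?B"
    using interior_of_subset[of X C'] by auto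
  ultimately show thesis
    using that \<open>compactin X ?B\<close> by blast
qed

text \<open>A compact neighbourhood of C that avoids the closed set outside the interior of C' lies
  in this interior.\<close>

lemma compact_nbhd_interpolate:
  assumes X: "compact_space X" "Hausdorff_space X" and C: "compactin X C" "compact_nbhd X C' C"
  obtains K where "compact_nbhd X K C" "compact_nbhd X C' K"
proof -
  let ?B = "topspace X - X interior_of C'"
  have "compactin X ?B"
    using X by (intro closedin_compact_space) auto
  moreover have "C \<inter> ?B = {}"
    using C by (auto simp: compact_nbhd_def)
  ultimately obtain K where K: "compact_nbhd X K C" "K \<inter> ?B = {}"
    using compact_nbhd_disjoint_exists[OF X C(1)] by blast
  then have "K \<subseteq> X interior_of C'"
    using compactin_subset_topspace unfolding compact_nbhd_def by fastforce
  then show thesis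
    using that K C by (auto simp: compact_nbhd_def)
qed

lemma compact_nbhd_Int:
  assumes "Hausdorff_space X" "compact_nbhd X K C" "compact_nbhd X K' C"
  shows "compact_nbhd X (K \<inter> K') C"
  using assms by (auto simp: compact_nbhd_def interior_of_Int compact_Int_closedin
      compactin_imp_closedin)

lemma compact_nbhd_subset: "compact_nbhd X K C \<Longrightarrow> C \<subseteq> K"
  using interior_of_subset[of X K] by (auto simp: compact_nbhd_def)

lemma compact_nbhd_topspace:
  "compact_space X \<Longrightarrow> C \<subseteq> topspace X \<Longrightarrow> compact_nbhd X (topspace X) C"
  by (auto simp: compact_nbhd_def compact_space_def)

lemma compact_space_spow:
  "compact (UNIV :: 's::topological_space set) \<Longrightarrow>
   compact_space (spow n :: (nat \<Rightarrow> 's) topology)"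
  unfolding compact_space_product_topology
  by (auto simp: compact_space_def)

lemma Hausdorff_space_euclidean_t2: "Hausdorff_space (euclidean :: 's::t2_space topology)"
  unfolding Hausdorff_space_def disjnt_def using separation_t2 by auto

lemma Hausdorff_space_spow: "Hausdorff_space (spow n :: (nat \<Rightarrow> 's::t2_space) topology)"
  by (simp add: Hausdorff_space_product_topology Hausdorff_space_euclidean_t2)

lemma tuple_in_topspace: "tuple ss \<in> topspace (spow (length ss))"
  by (auto simp: tuple_def topspace_product_topology)

text \<open>The relations \<open>sim\<close> use subsets of S \<times> S, atomic formulas use
  subsets of \<open>spow 2\<close>; this map carries compact neighbourhoods of the diagonal from the
  former to the latter.\<close>

lemma continuous_map_tuple2:
  "continuous_map euclidean (spow 2) (\<lambda>(a :: 's::topological_space, b). tuple [a, b])"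
proof -
  have "continuous_map euclidean euclidean
      (\<lambda>p :: 's \<times> 's. (case p of (a, b) \<Rightarrow> tuple [a, b]) k)" if "k < 2" for k
  proof -
    have "k = 0 \<or> k = 1"
      using that by auto
    then show ?thesis
    proof
      assume "k = 0"
      then have "(\<lambda>p :: 's \<times> 's. (case p of (a, b) \<Rightarrow> tuple [a, b]) k) = fst"
        by (auto simp: tuple_def)
      then show ?thesis
        by (auto intro: continuous_on_fst)
    next
      assume "k = 1"
      then have "(\<lambda>p :: 's \<times> 's. (case p of (a, b) \<Rightarrow> tuple [a, b]) k) = snd"
        by (auto simp: tuple_def)
      then show ?thesis
        by (auto intro: continuous_on_snd)
    qed
  qed
  moreover have "(\<lambda>(a, b). tuple [a, b]) ` UNIV \<subseteq> extensional {..<2 :: nat}"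
    by (auto simp: tuple_def)
  ultimately show ?thesis
    unfolding continuous_map_componentwise by simp
qed

lemma compactin_image_tuple2:
  assumes "compact D"
  shows "compactin (spow 2) ((\<lambda>(a, b). tuple [a, b]) ` D)"
  using image_compactin[OF _ continuous_map_tuple2] assms by auto

lemma tuple2_in_image_iff: "tuple [a, b] \<in> (\<lambda>(a, b). tuple [a, b]) ` D \<longleftrightarrow> (a, b) \<in> D"
proof -
  have "a = c \<and> b = d" if "tuple [a, b] = tuple [c, d]" for c d
    using fun_cong[OF that, of 0] fun_cong[OF that, of 1] by (auto simp: tuple_def)
  then show ?thesis
    by force
qed

lemma compact_nbhd_image_tuple2:
  fixes D :: "('s::t2_space \<times> 's) set"
  assumes "compact_nbhd euclidean D C"
  shows "compact_nbhd (spow 2) ((\<lambda>(a, b). tuple [a, b]) ` D) ((\<lambda>(a, b). tuple [a, b]) ` C)"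
proof -
  \<comment> \<open>The preimage of the interior of D under the inverse map, which sends f to (f 0,
    f 1). Continuity of the inverse makes it open.\<close>
  let ?V = "{f \<in> topspace (spow 2 :: (nat \<Rightarrow> 's) topology). (f 0, f 1) \<in> interior D}"
  have "continuous_map (spow 2) (prod_topology euclidean euclidean) (\<lambda>f :: nat \<Rightarrow> 's. (f 0, f 1))"
    by (intro continuous_map_pairedI continuous_map_product_projection) auto
  then have "openin (spow 2) ?V"
    by (intro openin_continuous_map_preimage[where Y = euclidean])
      (auto simp: euclidean_product_topology)
  moreover have "?V \<subseteq> (\<lambda>(a, b). tuple [a, b]) ` D"
  proof
    fix f assume f: "f \<in> ?V"
    then have "f k = undefined" if "\<not> k < 2" for k
      using that by (auto simp: PiE_def extensional_def)
    then have "f k = tuple [f 0, f 1] k" for k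
      by (cases "k < 2") (auto simp: tuple_def less_2_cases_iff)
    then have "f = tuple [f 0, f 1]"
      by blast
    moreover have "(f 0, f 1) \<in> D"
      using f interior_subset by blast
    ultimately show "f \<in> (\<lambda>(a, b). tuple [a, b]) ` D"
      by (metis tuple2_in_image_iff)
  qed
  moreover have "(\<lambda>(a, b). tuple [a, b]) ` C \<subseteq> ?V"
  proof -
    have "tuple [a, b] \<in> topspace (spow 2)" for a b :: 's
      using tuple_in_topspace[of "[a, b]"] by (simp add: numeral_2_eq_2)
    moreover have "(tuple [a, b] 0, tuple [a, b] 1) = (a, b)" for a b :: 's
      by (simp add: tuple_def)
    ultimately show ?thesis
      using assms by (auto simp: compact_nbhd_def)
  qed
  ultimately have "(\<lambda>(a, b). tuple [a, b]) ` C \<subseteq> spow 2 interior_of ((\<lambda>(a, b). tuple [a, b]) ` D)"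
    using interior_of_maximal by blast
  then show ?thesis
    using assms compactin_image_tuple2[of D] by (simp add: compact_nbhd_def)
qed

lemma closed_Id: "closed (Id :: ('s::t2_space \<times> 's) set)"
proof -
  have "closed {p :: 's \<times> 's. fst p = snd p}"
    by (intro closed_Collect_eq continuous_on_fst continuous_on_snd continuous_on_id)
  also have "{p :: 's \<times> 's. fst p = snd p} = Id"
    by auto
  finally show ?thesis .
qed

lemma compact_Id:
  assumes "compact (UNIV :: 's::t2_space set)"
  shows "compact (Id :: ('s \<times> 's) set)"
proof -
  have "compact (UNIV \<inter> (Id :: ('s \<times> 's) set))"
    using compact_Times[OF assms assms] closed_Id by (intro compact_Int_closed) auto
  then show ?thesis
    by simp
qed

text \<open>The diagonal is compact, so it has a compact neighbourhood avoiding any given point off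
  the diagonal.\<close>

lemma eq_if_in_all_compact_nbhds_Id:
  fixes a b :: "'s::t2_space"
  assumes "compact (UNIV :: 's set)" "\<And>D. compact_nbhd euclidean D Id \<Longrightarrow> (a, b) \<in> D"
  shows "a = b"
proof (rule ccontr)
  assume "a \<noteq> b"
  moreover have "compact (UNIV :: ('s \<times> 's) set)"
    using compact_Times[OF assms(1) assms(1)] by simp
  ultimately obtain D where "compact_nbhd euclidean D Id" "D \<inter> {(a, b)} = {}"
    using compact_nbhd_disjoint_exists[of euclidean Id "{(a, b)}"] compact_Id[OF assms(1)]
    by (auto simp: compact_space_def Hausdorff_space_euclidean_t2)
  then show False
    using assms(2) by auto
qed

section \<open>Formulas, substitutions and weakenings\<close>

lemma heval_cong: "(\<And>i. i \<in> hvars_hterm t \<Longrightarrow> v i = v' i) \<Longrightarrow> heval N v t = heval N v' t"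
proof (induction t)
  case (HApp F ts)
  then have "map (heval N v) ts = map (heval N v') ts"
    unfolding map_eq_conv hvars_hterm.simps by blast
  then show ?case
    by (simp del: map_eq_conv)
qed auto

lemma hsat_cong: "(\<And>i. i \<in> hvars_hform p \<Longrightarrow> v i = v' i) \<Longrightarrow> hsat N v p \<longleftrightarrow> hsat N v' p"
proof (induction p arbitrary: v v')
  case (HEq t u)
  then show ?case
    using heval_cong[of t v v' N] heval_cong[of u v v' N] by auto
next
  case (HRel R ts)
  then have "map (heval N v) ts = map (heval N v') ts"
    by (auto intro!: heval_cong)
  then show ?case
    by (simp del: map_eq_conv)
next
  case (HEx i p)
  have "hsat N (v(i := a)) p \<longleftrightarrow> hsat N (v'(i := a)) p" for a
    using HEx.prems by (intro HEx.IH) auto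
  then show ?case
    by (simp only: hsat.simps)
next
  case (HNeg p)
  have "hsat N v p \<longleftrightarrow> hsat N v' p"
    using HNeg.prems by (intro HNeg.IH) auto
  then show ?case
    by (simp only: hsat.simps)
next
  case (HConj p q)
  have "hsat N v p \<longleftrightarrow> hsat N v' p" "hsat N v q \<longleftrightarrow> hsat N v' q"
    using HConj.prems by (auto intro!: HConj.IH simp del: hsat.simps)
  then show ?case
    by (simp only: hsat.simps)
qed

lemma seval_cong:
  "(\<And>i. i \<in> hvars_sterm t \<Longrightarrow> v i = v' i) \<Longrightarrow> (\<And>i. i \<in> svars_sterm t \<Longrightarrow> w i = w' i) \<Longrightarrow>
   seval N v w t = seval N v' w' t"
proof (induction t)
  case (SCont F ts)
  then have "map (seval N v w) ts = map (seval N v' w') ts"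
    unfolding map_eq_conv hvars_sterm.simps svars_sterm.simps by blast
  then show ?case
    by (simp del: map_eq_conv)
next
  case (SApp g us ts)
  then have "map (seval N v w) ts = map (seval N v' w') ts"
    unfolding map_eq_conv hvars_sterm.simps svars_sterm.simps by blast
  moreover have "map (heval N v) us = map (heval N v') us"
    using SApp.prems by (auto intro!: heval_cong)
  ultimately show ?case
    by (simp del: map_eq_conv)
qed auto

lemma sat_cong:
  "(\<And>i. i \<in> hvars p \<Longrightarrow> v i = v' i) \<Longrightarrow> (\<And>i. i \<in> svars p \<Longrightarrow> w i = w' i) \<Longrightarrow>
   sat N v w p \<longleftrightarrow> sat N v' w' p"
proof (induction p arbitrary: v v' w w')
  case (RH p)
  then show ?case
    using hsat_cong[of p v v' N] by simp
next
  case (SIn ts C)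
  then have "map (seval N v w) ts = map (seval N v' w') ts"
    by (auto intro!: seval_cong)
  then show ?case
    by (simp del: map_eq_conv)
next
  case (Neg p)
  have "sat N v w p \<longleftrightarrow> sat N v' w' p"
    using Neg.prems by (intro Neg.IH) auto
  then show ?case
    by (simp only: sat.simps)
next
  case (Conj p q)
  have "sat N v w p \<longleftrightarrow> sat N v' w' p" "sat N v w q \<longleftrightarrow> sat N v' w' q"
    using Conj.prems by (auto intro!: Conj.IH simp del: sat.simps)
  then show ?case
    by (simp only: sat.simps)
next
  case (Disj p q)
  have "sat N v w p \<longleftrightarrow> sat N v' w' p" "sat N v w q \<longleftrightarrow> sat N v' w' q"
    using Disj.prems by (auto intro!: Disj.IH simp del: sat.simps)
  then show ?case
    by (simp only: sat.simps)
next
  case (AllH i p)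
  have "sat N (v(i := a)) w p \<longleftrightarrow> sat N (v'(i := a)) w' p" for a
    using AllH.prems by (intro AllH.IH) auto
  then show ?case
    by (simp only: sat.simps)
next
  case (ExH i p)
  have "sat N (v(i := a)) w p \<longleftrightarrow> sat N (v'(i := a)) w' p" for a
    using ExH.prems by (intro ExH.IH) auto
  then show ?case
    by (simp only: sat.simps)
next
  case (AllS i p)
  have "sat N v (w(i := a)) p \<longleftrightarrow> sat N v' (w'(i := a)) p" for a
    using AllS.prems by (intro AllS.IH) auto
  then show ?case
    by (simp only: sat.simps)
next
  case (ExS i p)
  have "sat N v (w(i := a)) p \<longleftrightarrow> sat N v' (w'(i := a)) p" for a
    using ExS.prems by (intro ExS.IH) auto
  then show ?case
    by (simp only: sat.simps)
qed

lemma finite_hvars_hterm: "finite (hvars_hterm t)"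
  by (induction t) auto

lemma finite_hvars_sterm: "finite (hvars_sterm t)"
  by (induction t) (auto simp: finite_hvars_hterm)

lemma finite_hvars_hform: "finite (hvars_hform p)"
  by (induction p) (auto simp: finite_hvars_hterm)

lemma finite_hvars: "finite (hvars p)"
  by (induction p) (auto simp: finite_hvars_sterm finite_hvars_hform)

text \<open>The flag allows one argument for both halves of the theorem: \<open>False\<close> gives
  the positive formulas, \<open>True\<close> the continuous ones.\<close>

definition forms :: "bool \<Rightarrow> ('f, 'r, 'g) lang \<Rightarrow> ('f, 'r, 'g, 's::topological_space) form set"
  where "forms c L = {p. wf_form L p \<and> positive p \<and> (c \<longrightarrow> no_home_atoms p)}"

lemma positive_forms_eq: "positive_forms L = forms False L"
  by (auto simp: positive_forms_def forms_def)

lemma continuous_forms_eq: "continuous_forms L = forms True L"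
  by (auto simp: continuous_forms_def forms_def)

lemma forms_simps [simp]:
  "RH h \<in> forms c L \<longleftrightarrow> wf_hform L h \<and> \<not> c"
  "SIn ts C \<in> forms c L \<longleftrightarrow>
     ts \<noteq> [] \<and> (\<forall>t\<in>set ts. wf_sterm L t) \<and> compactin (spow (length ts)) C"
  "Neg p \<notin> forms c L"
  "Conj p q \<in> forms c L \<longleftrightarrow> p \<in> forms c L \<and> q \<in> forms c L"
  "Disj p q \<in> forms c L \<longleftrightarrow> p \<in> forms c L \<and> q \<in> forms c L"
  "AllH i p \<in> forms c L \<longleftrightarrow> p \<in> forms c L"
  "ExH i p \<in> forms c L \<longleftrightarrow> p \<in> forms c L"
  "AllS i p \<in> forms c L \<longleftrightarrow> p \<in> forms c L"
  "ExS i p \<in> forms c L \<longleftrightarrow> p \<in> forms c L"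
  by (auto simp: forms_def)

lemma forms_imp_positive_forms: "p \<in> forms c L \<Longrightarrow> p \<in> positive_forms L"
  by (auto simp: forms_def positive_forms_def)

section \<open>Renaming of home variables and insertion of constants from S\<close>

primrec hsub_term :: "(nat \<Rightarrow> 'f hterm) \<Rightarrow> 'f hterm \<Rightarrow> 'f hterm" where
  "hsub_term \<sigma> (HVar i) = \<sigma> i"
| "hsub_term \<sigma> (HApp F ts) = HApp F (map (hsub_term \<sigma>) ts)"

abbreviation hren_term :: "(nat \<Rightarrow> nat) \<Rightarrow> 'f hterm \<Rightarrow> 'f hterm" where
  "hren_term f \<equiv> hsub_term (\<lambda>i. HVar (f i))"

primrec hren_form :: "(nat \<Rightarrow> nat) \<Rightarrow> ('f, 'r) hform \<Rightarrow> ('f, 'r) hform" where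
  "hren_form f (HEq t u) = HEq (hren_term f t) (hren_term f u)"
| "hren_form f (HRel R ts) = HRel R (map (hren_term f) ts)"
| "hren_form f (HNeg p) = HNeg (hren_form f p)"
| "hren_form f (HConj p q) = HConj (hren_form f p) (hren_form f q)"
| "hren_form f (HEx i p) = HEx (f i) (hren_form f p)"

text \<open>Arbitrary home terms, not only variables, are substituted because
  \<open>close_form\<close> needs terms such as f(x) in the place of variable 0. A point of S is
  inserted as a continuous function of no arguments.\<close>

primrec sub_term ::
  "(nat \<Rightarrow> 'f hterm) \<Rightarrow> (nat \<rightharpoonup> 's) \<Rightarrow> ('f, 'g, 's) sterm \<Rightarrow> ('f, 'g, 's) sterm" where
  "sub_term \<sigma> d (SVar i) = (case d i of None \<Rightarrow> SVar i | Some s \<Rightarrow> SCont (\<lambda>_. s) [])"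
| "sub_term \<sigma> d (SCont F ts) = SCont F (map (sub_term \<sigma> d) ts)"
| "sub_term \<sigma> d (SApp g us ts) = SApp g (map (hsub_term \<sigma>) us) (map (sub_term \<sigma> d) ts)"

text \<open>Bound home variables are renamed too, so \<open>sub f\<close> is meaningful only for injective \<open>f\<close>.\<close>

primrec sub ::
  "(nat \<Rightarrow> nat) \<Rightarrow> (nat \<rightharpoonup> 's) \<Rightarrow> ('f, 'r, 'g, 's) form \<Rightarrow> ('f, 'r, 'g, 's) form" where
  "sub f d (RH p) = RH (hren_form f p)"
| "sub f d (SIn ts C) = SIn (map (sub_term (\<lambda>i. HVar (f i)) d) ts) C"
| "sub f d (Neg p) = Neg (sub f d p)"
| "sub f d (Conj p q) = Conj (sub f d p) (sub f d q)"
| "sub f d (Disj p q) = Disj (sub f d p) (sub f d q)"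
| "sub f d (AllH i p) = AllH (f i) (sub f d p)"
| "sub f d (ExH i p) = ExH (f i) (sub f d p)"
| "sub f d (AllS i p) = AllS i (sub f (d(i := None)) p)"
| "sub f d (ExS i p) = ExS i (sub f (d(i := None)) p)"

lemma heval_hsub_term: "heval N v (hsub_term \<sigma> t) = heval N (\<lambda>i. heval N v (\<sigma> i)) t"
  by (induction t) (auto intro!: arg_cong[of _ _ "hfun N _"])

lemma heval_hren_term: "heval N v (hren_term f t) = heval N (v \<circ> f) t"
  by (simp add: heval_hsub_term comp_def)

lemma fun_upd_comp_inj: "inj f \<Longrightarrow> v(f i := a) \<circ> f = (v \<circ> f)(i := a)"
  by (auto simp: fun_eq_iff inj_eq)

lemma hsat_hren_form: "inj f \<Longrightarrow> hsat N v (hren_form f p) \<longleftrightarrow> hsat N (v \<circ> f) p"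
proof (induction p arbitrary: v)
  case (HRel R ts)
  have "heval N v \<circ> hren_term f = heval N (v \<circ> f)"
    by (rule ext) (simp add: heval_hren_term)
  then show ?case
    by (simp only: hsat.simps hren_form.simps map_map)
qed (auto simp: heval_hren_term fun_upd_comp_inj)

text \<open>An S-quantifier cancels the constant assigned to its variable; this identity is the
  quantifier case of \<open>sat_sub\<close>.\<close>

lemma plug_fun_upd_None: "plug (w(i := s)) (d(i := None)) = (plug w d)(i := s)"
  by (auto simp: plug_def fun_eq_iff split: option.split)

lemma seval_sub_term:
  "seval N v w (sub_term \<sigma> d t) = seval N (\<lambda>i. heval N v (\<sigma> i)) (plug w d) t"
  (is "_ = ?e t")
proof (induction t)
  case (SVar i)
  then show ?case
    by (auto simp: plug_def split: option.split)
next
  case (SCont F ts)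
  then have "map (seval N v w \<circ> sub_term \<sigma> d) ts = map ?e ts"
    unfolding map_eq_conv o_apply[of "seval N v w"] by blast
  then show ?case
    by (simp only: seval.simps sub_term.simps map_map)
next
  case (SApp g us ts)
  then have "map (seval N v w \<circ> sub_term \<sigma> d) ts = map ?e ts"
    unfolding map_eq_conv o_apply[of "seval N v w"] by blast
  moreover have "heval N v \<circ> hsub_term \<sigma> = heval N (\<lambda>i. heval N v (\<sigma> i))"
    by (rule ext) (simp add: heval_hsub_term)
  ultimately show ?case
    by (simp only: seval.simps sub_term.simps map_map)
qed

lemma sat_sub: "inj f \<Longrightarrow> sat N v w (sub f d p) \<longleftrightarrow> sat N (v \<circ> f) (plug w d) p"
proof (induction p arbitrary: v w d)
  case (SIn ts C)
  have "seval N v w \<circ> sub_term (\<lambda>i. HVar (f i)) d = seval N (v \<circ> f) (plug w d)"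
    by (rule ext) (simp add: seval_sub_term comp_def)
  then show ?case
    by (simp only: sat.simps sub.simps map_map)
qed (auto simp: hsat_hren_form fun_upd_comp_inj plug_fun_upd_None)

lemma wf_hsub_term: "wf_hterm L t \<Longrightarrow> (\<And>i. wf_hterm L (\<sigma> i)) \<Longrightarrow> wf_hterm L (hsub_term \<sigma> t)"
  by (induction t) auto

lemma wf_hren_form: "wf_hform L p \<Longrightarrow> wf_hform L (hren_form f p)"
  by (induction p) (auto simp: wf_hsub_term)

lemma wf_sub_term:
  "wf_sterm L t \<Longrightarrow> (\<And>i. wf_hterm L (\<sigma> i)) \<Longrightarrow> wf_sterm L (sub_term \<sigma> d t)"
  by (induction t) (auto simp: wf_hsub_term split: option.split)

lemma sub_in_forms: "p \<in> forms c L \<Longrightarrow> sub f d p \<in> forms c L"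
  by (induction p arbitrary: d) (auto simp: wf_hren_form wf_sub_term)

lemma hvars_hsub_term: "hvars_hterm (hsub_term \<sigma> t) = (\<Union>i\<in>hvars_hterm t. hvars_hterm (\<sigma> i))"
  by (induction t) auto

lemma hvars_sub_term:
  "hvars_sterm (sub_term \<sigma> d t) = (\<Union>i\<in>hvars_sterm t. hvars_hterm (\<sigma> i))"
  by (induction t) (auto simp: hvars_hsub_term split: option.split)

lemma hvars_hren_form: "inj f \<Longrightarrow> hvars_hform (hren_form f p) = f ` hvars_hform p"
  by (induction p) (auto simp: hvars_hsub_term inj_eq image_set_diff)

lemma hvars_sub: "inj f \<Longrightarrow> hvars (sub f d p) = f ` hvars p"
  by (induction p arbitrary: d) (auto simp: hvars_sub_term hvars_hren_form inj_eq image_set_diff)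

lemma svars_sub_term: "svars_sterm (sub_term \<sigma> d t) = svars_sterm t - dom d"
  by (induction t) (auto split: option.split)

lemma svars_sub: "svars (sub f d p) = svars p - dom d"
  by (induction p arbitrary: d) (auto simp: svars_sub_term)

lemma weakening_sub: "weakening p p' \<Longrightarrow> weakening (sub f d p) (sub f d p')"
  by (induction arbitrary: d rule: weakening.induct) (auto intro!: weakening.intros)

section \<open>Weakenings: existence, interpolation, meets and strong negations\<close>

inductive_cases weakening_RH: "weakening (RH h) p'"
inductive_cases weakening_SIn: "weakening (SIn ts C) p'"
inductive_cases weakening_Conj: "weakening (Conj p q) p'"
inductive_cases weakening_Disj: "weakening (Disj p q) p'"
inductive_cases weakening_AllH: "weakening (AllH i p) p'"
inductive_cases weakening_ExH: "weakening (ExH i p) p'"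
inductive_cases weakening_AllS: "weakening (AllS i p) p'"
inductive_cases weakening_ExS: "weakening (ExS i p) p'"

lemma weakening_hvars: "weakening p p' \<Longrightarrow> hvars p' = hvars p"
  by (induction rule: weakening.induct) auto

lemma weakening_in_forms: "weakening p p' \<Longrightarrow> p \<in> forms c L \<Longrightarrow> p' \<in> forms c L"
  by (induction rule: weakening.induct) (auto simp: compact_nbhd_def)

lemma weakening_imp: "weakening p p' \<Longrightarrow> sat N v w p \<Longrightarrow> sat N v w p'"
proof (induction arbitrary: v w rule: weakening.induct)
  case (SIn ts C' C)
  then show ?case
    using compact_nbhd_subset by fastforce
qed auto

lemma weakening_exists:
  fixes p :: "('f, 'r, 'g, 's::t2_space) form"
  assumes "compact (UNIV :: 's set)" "p \<in> forms c L"
  shows "\<exists>p'. weakening p p'"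
  using assms(2)
proof (induction p)
  case (SIn ts C)
  then have "C \<subseteq> topspace (spow (length ts))"
    by (simp only: forms_simps compactin_subset_topspace)
  then have "compact_nbhd (spow (length ts)) (topspace (spow (length ts))) C"
    by (intro compact_nbhd_topspace compact_space_spow assms(1))
  then show ?case
    by (blast intro: weakening.SIn)
qed (auto intro: weakening.intros)

lemma weakening_interpolate:
  fixes p :: "('f, 'r, 'g, 's::t2_space) form"
  assumes S: "compact (UNIV :: 's set)"
  shows "weakening p p' \<Longrightarrow> p \<in> forms c L \<Longrightarrow> \<exists>q. weakening p q \<and> weakening q p'"
proof (induction rule: weakening.induct)
  case (SIn ts C' C)
  then have C: "compactin (spow (length ts)) C"
    by simp
  obtain K where "compact_nbhd (spow (length ts)) K C" "compact_nbhd (spow (length ts)) C' K"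
    using compact_nbhd_interpolate[OF compact_space_spow[OF S] Hausdorff_space_spow C SIn.hyps] .
  then show ?case
    by (blast intro: weakening.SIn)
qed (auto intro: weakening.intros)

text \<open>Neighbourhoods are intersected atom by atom. Only an implication from \<open>q\<close>
  is claimed, since disjunctions and existential quantifiers do not distribute over the conjunction
  of \<open>p'\<close> and \<open>p''\<close>.\<close>

lemma weakening_meet:
  fixes p :: "('f, 'r, 'g, 's::t2_space) form"
  shows "weakening p p' \<Longrightarrow> weakening p p'' \<Longrightarrow>
    \<exists>q. weakening p q \<and> (\<forall>v w. sat N v w q \<longrightarrow> sat N v w p' \<and> sat N v w p'')"
proof (induction arbitrary: p'' rule: weakening.induct)
  case (RH h)
  then show ?case
    by (metis weakening.RH weakening_RH)
next
  case (SIn ts C' C)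
  obtain C'' where C'': "p'' = SIn ts C''" "compact_nbhd (spow (length ts)) C'' C"
    using SIn.prems by (auto elim: weakening_SIn)
  have "weakening (SIn ts C) (SIn ts (C' \<inter> C''))"
    using compact_nbhd_Int[OF Hausdorff_space_spow] SIn.hyps C'' by (blast intro: weakening.SIn)
  then show ?case
    using C'' by (intro exI[of _ "SIn ts (C' \<inter> C'')"]) auto
next
  case (Conj p p' q q')
  obtain r s where rs: "p'' = Conj r s" "weakening p r" "weakening q s"
    using Conj.prems by (auto elim: weakening_Conj)
  with Conj.IH(1)[OF rs(2)] Conj.IH(2)[OF rs(3)] show ?case
    by (meson sat.simps(4) weakening.Conj)
next
  case (Disj p p' q q')
  obtain r s where rs: "p'' = Disj r s" "weakening p r" "weakening q s"
    using Disj.prems by (auto elim: weakening_Disj)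
  with Disj.IH(1)[OF rs(2)] Disj.IH(2)[OF rs(3)] show ?case
    by (meson sat.simps(5) weakening.Disj)
next
  case (AllH p p' i)
  obtain r where r: "p'' = AllH i r" "weakening p r"
    using AllH.prems by (auto elim: weakening_AllH)
  with AllH.IH[OF r(2)] show ?case
    by (meson sat.simps(6) weakening.AllH)
next
  case (ExH p p' i)
  obtain r where r: "p'' = ExH i r" "weakening p r"
    using ExH.prems by (auto elim: weakening_ExH)
  with ExH.IH[OF r(2)] show ?case
    by (meson sat.simps(7) weakening.ExH)
next
  case (AllS p p' i)
  obtain r where r: "p'' = AllS i r" "weakening p r"
    using AllS.prems by (auto elim: weakening_AllS)
  with AllS.IH[OF r(2)] show ?case
    by (meson sat.simps(8) weakening.AllS)
next
  case (ExS p p' i)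
  obtain r where r: "p'' = ExS i r" "weakening p r"
    using ExS.prems by (auto elim: weakening_ExS)
  with ExS.IH[OF r(2)] show ?case
    by (meson sat.simps(9) weakening.ExS)
qed

text \<open>The weakenings of \<open>p\<close> are directed downwards, so a finite set of them is
  realized as soon as a single weakening is.\<close>

lemma weakening_finite_meet:
  fixes p :: "('f, 'r, 'g, 's::t2_space) form"
  assumes S: "compact (UNIV :: 's set)" "p \<in> forms c L"
    and Q: "finite Q" "\<And>q. q \<in> Q \<Longrightarrow> weakening p q"
  shows "\<exists>p'. weakening p p' \<and> (\<forall>q\<in>Q. \<forall>v w. sat N v w p' \<longrightarrow> sat N v w q)"
  using Q
proof (induction Q rule: finite_induct)
  case empty
  then show ?case
    using weakening_exists[OF S] by auto
next
  case (insert q Q)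
  then obtain p' where p': "weakening p p'" "\<forall>q\<in>Q. \<forall>v w. sat N v w p' \<longrightarrow> sat N v w q"
    by blast
  obtain p'' where "weakening p p''" "\<forall>v w. sat N v w p'' \<longrightarrow> sat N v w p' \<and> sat N v w q"
    using weakening_meet[OF p'(1), of q N] insert.prems by blast
  then show ?case
    using p'(2) by (intro exI[of _ p'']) auto
qed

text \<open>
  A negation is not positive, but \<open>\<not> p'\<close> and \<open>\<not> p\<close> are separated by a positive formula and a
  weakening of it.
\<close>

lemma weakening_strong_negation:
  fixes p :: "('f, 'r, 'g, 's::t2_space) form"
  assumes S: "compact (UNIV :: 's set)"
  shows "weakening p p' \<Longrightarrow> p \<in> forms c L \<Longrightarrow>
    \<exists>q q'. weakening q q' \<and> q \<in> forms c L \<and> hvars q = hvars p \<and> svars q = svars p \<and>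
      (\<forall>(N :: ('f, 'r, 'g, 's, 'u) struct) v w.
        (\<not> sat N v w p' \<longrightarrow> sat N v w q) \<and> \<not> (sat N v w q' \<and> sat N v w p))"
proof (induction rule: weakening.induct)
  case (RH h)
  then show ?case
    \<comment> \<open>Home formulas are closed under negation and are their own weakenings, so here
      the strong negation is the true negation.\<close>
    by (intro exI[of _ "RH (HNeg h)"]) (auto intro!: weakening.RH)
next
  case (SIn ts C' C)
  then have C: "compactin (spow (length ts)) C"
    by simp
  obtain B B' where B: "compact_nbhd (spow (length ts)) B' B" "compactin (spow (length ts)) B"
    "topspace (spow (length ts)) - C' \<subseteq> B" "B' \<inter> C = {}"
    using compact_nbhd_separation[OF compact_space_spow[OF S] Hausdorff_space_spow C SIn.hyps] .
  have "tuple (map (seval N v w) ts) \<in> topspace (spow (length ts))"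
    for N :: "('f, 'r, 'g, 's, 'u) struct" and v w
    using tuple_in_topspace[of "map (seval N v w) ts"] by simp
  then have "tuple (map (seval N v w) ts) \<in> C' \<or> tuple (map (seval N v w) ts) \<in> B"
    for N :: "('f, 'r, 'g, 's, 'u) struct" and v w
    using B(3) by blast
  moreover have "SIn ts B \<in> forms c L" "weakening (SIn ts B) (SIn ts B')"
    using B SIn.prems by (auto intro: weakening.SIn)
  ultimately show ?case
    using B(4) unfolding sat.simps hvars.simps svars.simps
    by - (rule exI[of _ "SIn ts B"], rule exI[of _ "SIn ts B'"], auto)
next
  case (Conj p p' q q')
  obtain r r' where r: "weakening r r'" "r \<in> forms c L" "hvars r = hvars p"
    "svars r = svars p" "\<forall>(N :: ('f, 'r, 'g, 's, 'u) struct) v w.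
        (\<not> sat N v w p' \<longrightarrow> sat N v w r) \<and> \<not> (sat N v w r' \<and> sat N v w p)"
    using Conj.IH(1) Conj.prems unfolding forms_simps by blast
  obtain s s' where s: "weakening s s'" "s \<in> forms c L" "hvars s = hvars q"
    "svars s = svars q" "\<forall>(N :: ('f, 'r, 'g, 's, 'u) struct) v w.
        (\<not> sat N v w q' \<longrightarrow> sat N v w s) \<and> \<not> (sat N v w s' \<and> sat N v w q)"
    using Conj.IH(2) Conj.prems unfolding forms_simps by blast
  \<comment> \<open>As in the de Morgan laws, every connective and quantifier is replaced by its
    dual; the same holds in the cases below.\<close>
  have "weakening (Disj r s) (Disj r' s')"
    using r s by (intro weakening.Disj)
  moreover have "Disj r s \<in> forms c L" "hvars (Disj r s) = hvars (Conj p q)"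
    "svars (Disj r s) = svars (Conj p q)"
    using r s by auto
  moreover have "\<forall>(N :: ('f, 'r, 'g, 's, 'u) struct) v w.
      (\<not> sat N v w (Conj p' q') \<longrightarrow> sat N v w (Disj r s)) \<and>
      \<not> (sat N v w (Disj r' s') \<and> sat N v w (Conj p q))"
    unfolding sat.simps using r(5) s(5) by blast
  ultimately show ?case
    by blast
next
  case (Disj p p' q q')
  obtain r r' where r: "weakening r r'" "r \<in> forms c L" "hvars r = hvars p"
    "svars r = svars p" "\<forall>(N :: ('f, 'r, 'g, 's, 'u) struct) v w.
        (\<not> sat N v w p' \<longrightarrow> sat N v w r) \<and> \<not> (sat N v w r' \<and> sat N v w p)"
    using Disj.IH(1) Disj.prems unfolding forms_simps by blast
  obtain s s' where s: "weakening s s'" "s \<in> forms c L" "hvars s = hvars q"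
    "svars s = svars q" "\<forall>(N :: ('f, 'r, 'g, 's, 'u) struct) v w.
        (\<not> sat N v w q' \<longrightarrow> sat N v w s) \<and> \<not> (sat N v w s' \<and> sat N v w q)"
    using Disj.IH(2) Disj.prems unfolding forms_simps by blast
  have "weakening (Conj r s) (Conj r' s')"
    using r s by (intro weakening.Conj)
  moreover have "Conj r s \<in> forms c L" "hvars (Conj r s) = hvars (Disj p q)"
    "svars (Conj r s) = svars (Disj p q)"
    using r s by auto
  moreover have "\<forall>(N :: ('f, 'r, 'g, 's, 'u) struct) v w.
      (\<not> sat N v w (Disj p' q') \<longrightarrow> sat N v w (Conj r s)) \<and>
      \<not> (sat N v w (Conj r' s') \<and> sat N v w (Disj p q))"
    unfolding sat.simps using r(5) s(5) by blast
  ultimately show ?case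
    by blast
next
  case (AllH p p' i)
  obtain r r' where r: "weakening r r'" "r \<in> forms c L" "hvars r = hvars p"
    "svars r = svars p" "\<forall>(N :: ('f, 'r, 'g, 's, 'u) struct) v w.
        (\<not> sat N v w p' \<longrightarrow> sat N v w r) \<and> \<not> (sat N v w r' \<and> sat N v w p)"
    using AllH.IH AllH.prems unfolding forms_simps by blast
  have "weakening (ExH i r) (ExH i r')"
    using r by (intro weakening.ExH)
  moreover have "ExH i r \<in> forms c L" "hvars (ExH i r) = hvars (AllH i p)"
    "svars (ExH i r) = svars (AllH i p)"
    using r by auto
  moreover have "\<forall>(N :: ('f, 'r, 'g, 's, 'u) struct) v w.
      (\<not> sat N v w (AllH i p') \<longrightarrow> sat N v w (ExH i r)) \<and>
      \<not> (sat N v w (ExH i r') \<and> sat N v w (AllH i p))"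
    unfolding sat.simps using r(5) by blast
  ultimately show ?case
    by blast
next
  case (ExH p p' i)
  obtain r r' where r: "weakening r r'" "r \<in> forms c L" "hvars r = hvars p"
    "svars r = svars p" "\<forall>(N :: ('f, 'r, 'g, 's, 'u) struct) v w.
        (\<not> sat N v w p' \<longrightarrow> sat N v w r) \<and> \<not> (sat N v w r' \<and> sat N v w p)"
    using ExH.IH ExH.prems unfolding forms_simps by blast
  have "weakening (AllH i r) (AllH i r')"
    using r by (intro weakening.AllH)
  moreover have "AllH i r \<in> forms c L" "hvars (AllH i r) = hvars (ExH i p)"
    "svars (AllH i r) = svars (ExH i p)"
    using r by auto
  moreover have "\<forall>(N :: ('f, 'r, 'g, 's, 'u) struct) v w.
      (\<not> sat N v w (ExH i p') \<longrightarrow> sat N v w (AllH i r)) \<and>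
      \<not> (sat N v w (AllH i r') \<and> sat N v w (ExH i p))"
    unfolding sat.simps using r(5) by blast
  ultimately show ?case
    by blast
next
  case (AllS p p' i)
  obtain r r' where r: "weakening r r'" "r \<in> forms c L" "hvars r = hvars p"
    "svars r = svars p" "\<forall>(N :: ('f, 'r, 'g, 's, 'u) struct) v w.
        (\<not> sat N v w p' \<longrightarrow> sat N v w r) \<and> \<not> (sat N v w r' \<and> sat N v w p)"
    using AllS.IH AllS.prems unfolding forms_simps by blast
  have "weakening (ExS i r) (ExS i r')"
    using r by (intro weakening.ExS)
  moreover have "ExS i r \<in> forms c L" "hvars (ExS i r) = hvars (AllS i p)"
    "svars (ExS i r) = svars (AllS i p)"
    using r by auto
  moreover have "\<forall>(N :: ('f, 'r, 'g, 's, 'u) struct) v w.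
      (\<not> sat N v w (AllS i p') \<longrightarrow> sat N v w (ExS i r)) \<and>
      \<not> (sat N v w (ExS i r') \<and> sat N v w (AllS i p))"
    unfolding sat.simps using r(5) by blast
  ultimately show ?case
    by blast
next
  case (ExS p p' i)
  obtain r r' where r: "weakening r r'" "r \<in> forms c L" "hvars r = hvars p"
    "svars r = svars p" "\<forall>(N :: ('f, 'r, 'g, 's, 'u) struct) v w.
        (\<not> sat N v w p' \<longrightarrow> sat N v w r) \<and> \<not> (sat N v w r' \<and> sat N v w p)"
    using ExS.IH ExS.prems unfolding forms_simps by blast
  have "weakening (AllS i r) (AllS i r')"
    using r by (intro weakening.AllS)
  moreover have "AllS i r \<in> forms c L" "hvars (AllS i r) = hvars (ExS i p)"
    "svars (AllS i r) = svars (ExS i p)"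
    using r by auto
  moreover have "\<forall>(N :: ('f, 'r, 'g, 's, 'u) struct) v w.
      (\<not> sat N v w (ExS i p') \<longrightarrow> sat N v w (AllS i r)) \<and>
      \<not> (sat N v w (AllS i r') \<and> sat N v w (ExS i p))"
    unfolding sat.simps using r(5) by blast
  ultimately show ?case
    by blast
qed

lemma tv_weakeningD:
  assumes "tv_weakening U H M" "p \<in> H" "finite X" "v ` (hvars p - X) \<subseteq> M" "a ` X \<subseteq> home U"
    "sat U (override_on v a X) w p" "weakening p p'"
  shows "\<exists>a. a ` X \<subseteq> M \<and> sat U (override_on v a X) w p'"
  using assms(1)[unfolded tv_weakening_def, rule_format, OF assms(2), of X v w p'] assms(3-7)
  by auto

lemma tv_negationD:
  assumes "tv_negation U H M" "p \<in> H" "finite X" "v ` (hvars p - X) \<subseteq> M" "a ` X \<subseteq> home U"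
    "\<not> sat U (override_on v a X) w p"
  shows "\<exists>a. a ` X \<subseteq> M \<and> \<not> sat U (override_on v a X) w p"
  using assms(1)[unfolded tv_negation_def, rule_format, OF assms(2), of X v w] assms(3-6)
  by auto

section \<open>Saturation\<close>

text \<open>Density concerns formulas without free S-variables, whereas the Tarski--Vaught
  conditions evaluate them by a valuation \<open>w\<close>. Inserting the values of \<open>w\<close>
  as constants reconciles the two.\<close>

lemma sat_sub_consts: "sat N v w' (sub id (\<lambda>i. Some (w i)) p) \<longleftrightarrow> sat N v w p"
proof -
  have "plug w' (\<lambda>i. Some (w i)) = w"
    by (simp add: plug_def)
  then show ?thesis
    using sat_sub[of id N v w' "\<lambda>i. Some (w i)" p] by simp
qed

lemma hvars_sub_consts: "hvars (sub id (\<lambda>i. Some (w i)) p) = hvars p"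
  by (simp add: hvars_sub)

lemma svars_sub_consts: "svars (sub id (\<lambda>i. Some (w i)) p) = {}"
  by (auto simp: svars_sub)

locale saturated_structure =
  fixes L :: "('f, 'r, 'g) lang"
    and U :: "('f, 'r, 'g, 's::t2_space, 'u) struct"
  assumes compact_S: "compact (UNIV :: 's set)"
    and standard: "standard_structure L U"
    and infinite_home: "infinite (home U)"
    and saturated: "p_saturated L U"
begin

text \<open>In an infinite home sort every finite set of parameters is small in the sense of
  saturation.\<close>

lemma realized_in_if_finitely_realized:
  assumes "\<And>p e. (p, e) \<in> P \<Longrightarrow> p \<in> positive_forms L \<and> ran e \<subseteq> A" "A \<subseteq> home U" "finite A"
    and "\<And>Q. finite Q \<Longrightarrow> Q \<subseteq> P \<Longrightarrow> realized_in U Q"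
  shows "realized_in U P"
proof -
  have sub: "(\<Union>(p, e)\<in>P. ran e) \<subseteq> A"
    using assms(1) by fast
  then have "(\<Union>(p, e)\<in>P. ran e) \<prec> home U"
    using assms(3) infinite_home finite_lesspoll_infinite finite_subset by metis
  moreover have "\<forall>(p, e)\<in>P. p \<in> positive_forms L \<and> ran e \<subseteq> home U"
    using assms(1,2) by fast
  ultimately show ?thesis
    using saturated assms(4) unfolding p_saturated_def by blast
qed

text \<open>The set of all weakenings of \<open>p\<close> is a positive type in the variables X and
  Y. By \<open>weakening_finite_meet\<close> its finite realizability reduces to the realizability
  of each single weakening, and saturation does the rest.\<close>

lemma weakenings_jointly_realized:
  assumes p: "p \<in> forms c L" and v: "v ` (hvars p - X) \<subseteq> home U"
    and real: "\<And>p'. weakening p p' \<Longrightarrow>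
      \<exists>a b. a ` X \<subseteq> home U \<and> sat U (override_on v a X) (override_on w b Y) p'"
  shows "\<exists>a b. a ` X \<subseteq> home U \<and>
      (\<forall>p'. weakening p p' \<longrightarrow> sat U (override_on v a X) (override_on w b Y) p')"
proof -
  \<comment> \<open>Outside X and Y the values are fixed: home variables by parameters in
    \<open>e\<close>, S-variables by constants in \<open>d\<close>.\<close>
  define e where "e = (\<lambda>i. if i \<in> hvars p - X then Some (v i) else None)"
  define d where "d = (\<lambda>i. if i \<in> Y then None else Some (w i))"
  define P where "P = {(sub id d p', e) |p'. weakening p p'}"
  obtain h where h: "h \<in> home U"
    using infinite_home by fastforce
  have sat_P: "sat U (plug a e) b (sub id d p') \<longleftrightarrow>
      sat U (override_on v a X) (override_on w b Y) p'" if "weakening p p'" for a b p'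
  proof -
    have "plug b d = override_on w b Y"
      by (auto simp: plug_def d_def override_on_def)
    then have "sat U (plug a e) b (sub id d p') \<longleftrightarrow> sat U (plug a e) (override_on w b Y) p'"
      using sat_sub[of id U "plug a e" b d p'] by simp
    also have "\<dots> \<longleftrightarrow> sat U (override_on v a X) (override_on w b Y) p'"
      using weakening_hvars[OF that]
      by (intro sat_cong) (auto simp: plug_def e_def override_on_def)
    finally show ?thesis .
  qed
  have "realized_in U P"
  proof (rule realized_in_if_finitely_realized[where A = "v ` (hvars p - X)"])
    show "q \<in> positive_forms L \<and> ran g \<subseteq> v ` (hvars p - X)" if "(q, g) \<in> P" for q g
    proof -
      have "g = e" "q \<in> forms c L"
        using that weakening_in_forms[OF _ p] sub_in_forms unfolding P_def by blast+
      then show ?thesis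
        using forms_imp_positive_forms by (auto simp: e_def ran_def split: if_splits)
    qed
  next
    fix Q assume Q: "finite Q" "Q \<subseteq> P"
    then have "Q \<subseteq> (\<lambda>p'. (sub id d p', e)) ` {p'. weakening p p'}"
      by (auto simp: P_def)
    then obtain R where R: "R \<subseteq> {p'. weakening p p'}" "finite R"
      "Q = (\<lambda>p'. (sub id d p', e)) ` R"
      using finite_subset_image[OF Q(1)] by metis
    obtain p' where p': "weakening p p'" "\<forall>q\<in>R. \<forall>v w. sat U v w p' \<longrightarrow> sat U v w q"
      using weakening_finite_meet[OF compact_S p R(2)] R(1) by blast
    obtain a b where a: "a ` X \<subseteq> home U" "sat U (override_on v a X) (override_on w b Y) p'"
      using real[OF p'(1)] by blast
    \<comment> \<open>\<open>realized_in\<close> wants every variable to have a value in the home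
      sort, hence the default \<open>h\<close> outside X.\<close>
    define a' where "a' = (\<lambda>i. if i \<in> X then a i else h)"
    have eq: "override_on v a' X = override_on v a X"
      by (auto simp: a'_def override_on_def)
    have "sat U (plug a' e) b (sub id d q)" if "q \<in> R" for q
    proof -
      have "weakening p q"
        using that R(1) by blast
      then show ?thesis
        unfolding sat_P[OF \<open>weakening p q\<close>] eq using p'(2) a(2) that by blast
    qed
    moreover have "range a' \<subseteq> home U"
      using a(1) h by (auto simp: a'_def)
    ultimately show "realized_in U Q"
      unfolding realized_in_def R(3) by blast
  qed (use v finite_hvars[of p] in auto)
  then obtain a b where ab: "range a \<subseteq> home U" "\<forall>(q, e)\<in>P. sat U (plug a e) b q"
    unfolding realized_in_def by blast
  have "sat U (override_on v a X) (override_on w b Y) p'" if "weakening p p'" for p'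
  proof -
    have "(sub id d p', e) \<in> P"
      using that by (auto simp: P_def)
    then show ?thesis
      using ab(2) sat_P[OF that] by blast
  qed
  then show ?thesis
    using ab(1) by blast
qed

text \<open>For atoms this is separation of a point from a compact set. If a disjunction fails,
  weakenings that refute the disjuncts combine to a weakening refuting it. In the existential cases
  the witness depends on the weakening, and \<open>weakenings_jointly_realized\<close> supplies a
  common one.\<close>

lemma sat_if_weakenings:
  assumes "p \<in> forms c L" "v ` hvars p \<subseteq> home U" "\<And>p'. weakening p p' \<Longrightarrow> sat U v w p'"
  shows "sat U v w p"
  using assms
proof (induction p arbitrary: v w)
  case (RH h)
  then show ?case
    using weakening.RH by blast
next
  case (SIn ts C)
  let ?x = "tuple (map (seval U v w) ts)" and ?X = "spow (length ts) :: (nat \<Rightarrow> 's) topology"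
  have "?x \<in> topspace ?X"
    using tuple_in_topspace[of "map (seval U v w) ts"] by simp
  then have x: "compactin ?X {?x}"
    by (metis compactin_sing)
  have C: "compactin ?X C"
    using SIn.prems(1) by simp
  show ?case
  proof (rule ccontr)
    assume "\<not> sat U v w (SIn ts C)"
    then have "C \<inter> {?x} = {}"
      by simp
    then obtain K where "compact_nbhd ?X K C" "K \<inter> {?x} = {}"
      using compact_nbhd_disjoint_exists[OF compact_space_spow[OF compact_S] Hausdorff_space_spow C x]
      by blast
    then show False
      using SIn.prems(3)[OF weakening.SIn] by auto
  qed
next
  case (Conj p q)
  \<comment> \<open>A weakening of one conjunct becomes a weakening of the conjunction only when
    paired with some weakening of the other.\<close>
  obtain p0 q0 where pq: "weakening p p0" "weakening q q0"
    using weakening_exists[OF compact_S] Conj.prems(1) unfolding forms_simps by metis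
  have "sat U v w p'" if "weakening p p'" for p'
    using Conj.prems(3)[OF weakening.Conj[OF that pq(2)]] by simp
  moreover have "sat U v w q'" if "weakening q q'" for q'
    using Conj.prems(3)[OF weakening.Conj[OF pq(1) that]] by simp
  moreover have "p \<in> forms c L" "q \<in> forms c L" "v ` hvars p \<subseteq> home U" "v ` hvars q \<subseteq> home U"
    using Conj.prems by auto
  ultimately show ?case
    unfolding sat.simps using Conj.IH by blast
next
  case (Disj p q)
  have F: "p \<in> forms c L" "q \<in> forms c L" "v ` hvars p \<subseteq> home U" "v ` hvars q \<subseteq> home U"
    using Disj.prems by auto
  show ?case
  proof (rule ccontr)
    assume "\<not> ?case"
    then obtain p' q' where "weakening p p'" "\<not> sat U v w p'" "weakening q q'" "\<not> sat U v w q'"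
      using Disj.IH F unfolding sat.simps by blast
    then show False
      using Disj.prems(3)[OF weakening.Disj] by auto
  qed
next
  case (AllH i p)
  have "sat U (v(i := a)) w p" if "a \<in> home U" for a
  proof (rule AllH.IH)
    show "sat U (v(i := a)) w p'" if "weakening p p'" for p'
      using AllH.prems(3)[OF weakening.AllH[OF that]] \<open>a \<in> home U\<close> by simp
  qed (use AllH.prems that in auto)
  then show ?case
    by simp
next
  case (ExH i p)
  have F: "p \<in> forms c L" "v ` (hvars p - {i}) \<subseteq> home U"
    using ExH.prems by auto
  have upd: "override_on v a {i} = v(i := a i)" "override_on w b {} = w" for a b
    by (auto simp: override_on_def)
  have "\<exists>a b. a ` {i} \<subseteq> home U \<and> sat U (override_on v a {i}) (override_on w b {}) p'"
    if p': "weakening p p'" for p'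
  proof -
    obtain a where "a \<in> home U" "sat U (v(i := a)) w p'"
      using ExH.prems(3)[OF weakening.ExH[OF p']] by auto
    then show ?thesis
      unfolding upd by (intro exI[of _ "\<lambda>_. a"]) auto
  qed
  then obtain a where a: "a ` {i} \<subseteq> home U" "\<forall>p'. weakening p p' \<longrightarrow> sat U (v(i := a i)) w p'"
    using weakenings_jointly_realized[OF F, of w "{}"] unfolding upd by blast
  have "(v(i := a i)) ` hvars p \<subseteq> home U"
    using a(1) F(2) by auto
  then have "sat U (v(i := a i)) w p"
    using a(2) F(1) ExH.IH by blast
  then show ?case
    using a(1) by auto
next
  case (AllS i p)
  have "sat U v (w(i := a)) p" for a
  proof (rule AllS.IH)
    show "sat U v (w(i := a)) p'" if "weakening p p'" for p'
      using AllS.prems(3)[OF weakening.AllS[OF that]] by simp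
  qed (use AllS.prems in auto)
  then show ?case
    by simp
next
  case (ExS i p)
  have F: "p \<in> forms c L" "v ` (hvars p - {}) \<subseteq> home U"
    using ExS.prems by auto
  have upd: "override_on w b {i} = w(i := b i)" "override_on v a {} = v" for a b
    by (auto simp: override_on_def)
  have "\<exists>a b. a ` {} \<subseteq> home U \<and> sat U (override_on v a {}) (override_on w b {i}) p'"
    if p': "weakening p p'" for p'
  proof -
    obtain b where "sat U v (w(i := b)) p'"
      using ExS.prems(3)[OF weakening.ExS[OF p']] by auto
    then show ?thesis
      unfolding upd by (intro exI[of _ "\<lambda>_. b"] exI[of _ v]) auto
  qed
  then obtain b where b: "\<forall>p'. weakening p p' \<longrightarrow> sat U v (w(i := b i)) p'"
    using weakenings_jointly_realized[OF F, of w "{i}"] unfolding upd by blast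
  have "v ` hvars p \<subseteq> home U"
    using F(2) by simp
  then have "sat U v (w(i := b i)) p"
    using b F(1) ExS.IH by blast
  then show ?case
    by auto
qed simp

lemma realized_if_weakenings_realized:
  assumes p: "p \<in> forms c L" and v: "v ` (hvars p - X) \<subseteq> home U"
    and real: "\<And>p'. weakening p p' \<Longrightarrow>
      \<exists>a b. a ` X \<subseteq> home U \<and> sat U (override_on v a X) (override_on w b Y) p'"
  shows "\<exists>a b. a ` X \<subseteq> home U \<and> sat U (override_on v a X) (override_on w b Y) p"
proof -
  obtain a b where ab: "a ` X \<subseteq> home U"
    "\<forall>p'. weakening p p' \<longrightarrow> sat U (override_on v a X) (override_on w b Y) p'"
    using weakenings_jointly_realized[OF p v, of w Y] real by blast
  have "override_on v a X ` hvars p \<subseteq> home U"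
    using ab(1) v by (auto simp: override_on_def)
  then show ?thesis
    using sat_if_weakenings[OF p] ab by blast
qed

section \<open>Independence of the Tarski--Vaught conditions from the dense set\<close>

text \<open>U is itself a standard model of its positive theory, so density applies to it. Variables
  that do not occur are given a default value, since density speaks about valuations with all values
  in the home sort.\<close>

lemma dense_moduloD:
  assumes "dense_modulo TYPE('u) L (positive_theory L U) F H" "p \<in> F" "svars p = {}"
    "weakening p p'"
  obtains q where "q \<in> H" "hvars q \<subseteq> hvars p" "svars q = {}"
    "\<And>v w. v ` hvars p \<subseteq> home U \<Longrightarrow>
      (sat U v w p \<longrightarrow> sat U v w q) \<and> (sat U v w q \<longrightarrow> sat U v w p')"
proof -
  have "\<exists>q\<in>H. hvars q \<subseteq> hvars p \<and> svars q = {} \<and>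
      (\<forall>N :: ('f, 'r, 'g, 's, 'u) struct.
        standard_structure L N \<and> (\<forall>x\<in>positive_theory L U. valid_in N x) \<longrightarrow>
        (\<forall>v w. range v \<subseteq> home N \<longrightarrow>
          (sat N v w p \<longrightarrow> sat N v w q) \<and> (sat N v w q \<longrightarrow> sat N v w p')))"
    using assms(1)[unfolded dense_modulo_def, rule_format, OF assms(2), of p'] assms(3,4) by simp
  then obtain q where q: "q \<in> H" "hvars q \<subseteq> hvars p" "svars q = {}"
    "standard_structure L U \<and> (\<forall>x\<in>positive_theory L U. valid_in U x) \<longrightarrow>
      (\<forall>v w. range v \<subseteq> home U \<longrightarrow>
        (sat U v w p \<longrightarrow> sat U v w q) \<and> (sat U v w q \<longrightarrow> sat U v w p'))"
    by meson
  have imp: "(sat U v w p \<longrightarrow> sat U v w q) \<and> (sat U v w q \<longrightarrow> sat U v w p')"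
    if "range v \<subseteq> home U" for v w
    using q(4) standard that unfolding positive_theory_def by blast
  obtain h where h: "h \<in> home U"
    using infinite_home by fastforce
  have "(sat U v w p \<longrightarrow> sat U v w q) \<and> (sat U v w q \<longrightarrow> sat U v w p')"
    if v: "v ` hvars p \<subseteq> home U" for v w
  proof -
    define v' where "v' = override_on (\<lambda>_. h) v (hvars p)"
    have "range v' \<subseteq> home U"
      using v h by (auto simp: v'_def override_on_def)
    moreover have "sat U v w r \<longleftrightarrow> sat U v' w r" if "hvars r \<subseteq> hvars p" for r
      using that by (intro sat_cong) (auto simp: v'_def override_on_def)
    ultimately show ?thesis
      using q(2) imp[of v' w] weakening_hvars[OF assms(4)] by simp
  qed
  then show thesis
    using that q(1-3) by blast
qed

text \<open>Density controls \<open>q\<close> but not the weakenings of \<open>q\<close>, which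
  condition (2) produces; this lemma controls those as well. If every weakening of \<open>p\<close>
  were compatible with the failure of \<open>q'\<close>, all weakenings of the conjunction of
  \<open>p\<close> with a strong negation \<open>r\<close> of \<open>q'\<close> would be realized.
  Saturation would then realize the conjunction itself, contradicting that \<open>p\<close> implies
  \<open>q\<close>.\<close>

lemma weakening_below:
  assumes p: "p \<in> forms c L" and q: "q \<in> forms c L" "weakening q q'"
    and imp: "\<And>v w. v ` (hvars p \<union> hvars q) \<subseteq> home U \<Longrightarrow> sat U v w p \<Longrightarrow> sat U v w q"
  shows "\<exists>p'. weakening p p' \<and>
    (\<forall>v w. v ` (hvars p \<union> hvars q) \<subseteq> home U \<longrightarrow> sat U v w p' \<longrightarrow> sat U v w q')"
proof (rule ccontr)
  assume contra: "\<not> ?thesis"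
  obtain r r' where r: "weakening r r'" "r \<in> forms c L" "hvars r = hvars q"
    "\<And>(N :: ('f, 'r, 'g, 's, 'u) struct) v w. \<not> sat N v w q' \<Longrightarrow> sat N v w r"
    "\<And>(N :: ('f, 'r, 'g, 's, 'u) struct) v w. \<not> (sat N v w r' \<and> sat N v w q)"
    using weakening_strong_negation[OF compact_S q(2,1)] by metis
  obtain h where h: "h \<in> home U"
    using infinite_home by fastforce
  \<comment> \<open>All occurring variables stay free; \<open>?h\<close> and \<open>?w\<close>
    merely fill the places for parameters.\<close>
  let ?X = "hvars p \<union> hvars q" and ?h = "\<lambda>_ :: nat. h" and ?w = "\<lambda>_ :: nat. undefined :: 's"
  have "\<exists>a b. a ` ?X \<subseteq> home U \<and> sat U (override_on ?h a ?X) (override_on ?w b UNIV) s"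
    if "weakening (Conj p r) s" for s
  proof -
    obtain p' r'' where s: "s = Conj p' r''" "weakening p p'" "weakening r r''"
      using \<open>weakening (Conj p r) s\<close> by (auto elim: weakening_Conj)
    obtain a b where a: "a ` ?X \<subseteq> home U" "sat U a b p'" "\<not> sat U a b q'"
      using contra s(2) by blast
    then have "sat U a b r''"
      using weakening_imp[OF s(3)] r(4) by blast
    then have "sat U a b s"
      using s(1) a(2) by simp
    moreover have "sat U (override_on ?h a ?X) (override_on ?w b UNIV) s \<longleftrightarrow> sat U a b s"
      using s weakening_hvars[OF s(2)] weakening_hvars[OF s(3)] r(3)
      by (intro sat_cong) (auto simp: override_on_def)
    ultimately show ?thesis
      using a(1) by blast
  qed
  then obtain a b where ab: "a ` ?X \<subseteq> home U"
    "sat U (override_on ?h a ?X) (override_on ?w b UNIV) (Conj p r)"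
    using realized_if_weakenings_realized[of "Conj p r" c ?h ?X ?w UNIV] p r(2,3) by auto
  have "override_on ?h a ?X ` ?X \<subseteq> home U"
    using ab(1) by (auto simp: override_on_def)
  then have "sat U (override_on ?h a ?X) (override_on ?w b UNIV) q"
    using imp ab(2) by simp
  moreover have "sat U (override_on ?h a ?X) (override_on ?w b UNIV) r'"
    using ab(2) by (intro weakening_imp[OF r(1)]) simp
  ultimately show False
    using r(5) by simp
qed

text \<open>Where \<open>p\<close> fails, a weakening \<open>p'\<close> fails too, so a strong
  negation \<open>r\<close> holds there. An approximation \<open>q\<close> of \<open>r\<close> in H
  then holds as well, and condition (2) finds in M a point of a weakening of \<open>q\<close> that
  is still inconsistent with \<open>p\<close>.\<close>

lemma tv_negation_if_tv_weakening_dense: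
  assumes H: "H \<subseteq> forms c L" "dense_modulo TYPE('u) L (positive_theory L U) (forms c L) H"
    and M: "M \<subseteq> home U" and tv: "tv_weakening U H M"
  shows "tv_negation U (forms c L) M"
  unfolding tv_negation_def
proof (intro ballI allI impI, elim conjE exE)
  fix p X v w a
  assume p: "p \<in> forms c L" and X: "finite X" and v: "v ` (hvars p - X) \<subseteq> M"
    and a: "a ` X \<subseteq> home U" "sat U (override_on v a X) w (Neg p)"
  have "override_on v a X ` hvars p \<subseteq> home U"
    using a(1) v M by (auto simp: override_on_def)
  then obtain p' where p': "weakening p p'" "\<not> sat U (override_on v a X) w p'"
    using sat_if_weakenings[OF p] a(2) unfolding sat.simps by blast
  obtain r r' where r: "weakening r r'" "r \<in> forms c L" "hvars r = hvars p"
    "\<And>(N :: ('f, 'r, 'g, 's, 'u) struct) v w. \<not> sat N v w p' \<Longrightarrow> sat N v w r"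
    "\<And>(N :: ('f, 'r, 'g, 's, 'u) struct) v w. \<not> (sat N v w r' \<and> sat N v w p)"
    using weakening_strong_negation[OF compact_S p'(1) p] by metis
  \<comment> \<open>Density places \<open>q\<close> between \<open>r\<close> and \<open>r1\<close>;
    the gap from \<open>r1\<close> to \<open>r'\<close> is what \<open>weakening_below\<close> uses
    to keep a weakening of \<open>q\<close> under \<open>r'\<close>.\<close>
  obtain r1 where r1: "weakening r r1" "weakening r1 r'"
    using weakening_interpolate[OF compact_S r(1,2)] by blast
  let ?s = "sub id (\<lambda>i. Some (w i))"
  have ws: "weakening (?s r) (?s r1)" "weakening (?s r1) (?s r')" "?s r \<in> forms c L" "?s r1 \<in> forms c L"
    using r1 r(2) weakening_in_forms[OF r1(1) r(2)] by (auto simp: weakening_sub sub_in_forms)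
  obtain q where q: "q \<in> H" "hvars q \<subseteq> hvars (?s r)"
    "\<And>v w. v ` hvars (?s r) \<subseteq> home U \<Longrightarrow>
      (sat U v w (?s r) \<longrightarrow> sat U v w q) \<and> (sat U v w q \<longrightarrow> sat U v w (?s r1))"
    using dense_moduloD[OF H(2) ws(3) svars_sub_consts ws(1)] by metis
  have hv: "hvars (?s r) = hvars p" "hvars q \<union> hvars (?s r1) = hvars p"
    using q(2) r(3) weakening_hvars[OF r1(1)] unfolding hvars_sub_consts by auto
  obtain q' where q': "weakening q q'"
    "\<And>v w. v ` hvars p \<subseteq> home U \<Longrightarrow> sat U v w q' \<Longrightarrow> sat U v w (?s r')"
    using weakening_below[of q c "?s r1" "?s r'"] q(1,3) H(1) ws(2,4) unfolding hv by blast
  have "sat U (override_on v a X) w q"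
    using q(3) p'(2) r(4) \<open>override_on v a X ` hvars p \<subseteq> home U\<close>
    unfolding hv sat_sub_consts by blast
  moreover have "v ` (hvars q - X) \<subseteq> M"
    using v hv by blast
  ultimately obtain b where b: "b ` X \<subseteq> M" "sat U (override_on v b X) w q'"
    using tv_weakeningD[OF tv q(1) X _ a(1) _ q'(1)] by blast
  have "override_on v b X ` hvars p \<subseteq> home U"
    using b(1) v M by (auto simp: override_on_def)
  then have "sat U (override_on v b X) w r'"
    using q'(2) b(2) unfolding sat_sub_consts by blast
  then have "sat U (override_on v b X) w (Neg p)"
    using r(5) unfolding sat.simps by blast
  then show "\<exists>a. a ` X \<subseteq> M \<and> sat U (override_on v a X) w (Neg p)"
    using b(1) by blast
qed

text \<open>With \<open>r\<close> and \<open>r'\<close> from the strong negation of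
  \<open>p'\<close>, take \<open>q\<close> in H between them. Where \<open>p\<close> holds
  \<open>r'\<close> fails, so \<open>q\<close> fails; where \<open>q\<close> fails in M so does
  \<open>r\<close>, and then \<open>p'\<close> holds.\<close>

lemma tv_weakening_if_tv_negation_dense:
  assumes H: "dense_modulo TYPE('u) L (positive_theory L U) (forms c L) H"
    and M: "M \<subseteq> home U" and tv: "tv_negation U H M"
  shows "tv_weakening U (forms c L) M"
  unfolding tv_weakening_def
proof (intro ballI allI impI, elim conjE exE)
  fix p X v w p' a
  assume p: "p \<in> forms c L" and X: "finite X" and v: "v ` (hvars p - X) \<subseteq> M"
    and p': "weakening p p'"
    and a: "a ` X \<subseteq> home U" "sat U (override_on v a X) w p"
  obtain r r' where r: "weakening r r'" "r \<in> forms c L" "hvars r = hvars p"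
    "\<And>(N :: ('f, 'r, 'g, 's, 'u) struct) v w. \<not> sat N v w p' \<Longrightarrow> sat N v w r"
    "\<And>(N :: ('f, 'r, 'g, 's, 'u) struct) v w. \<not> (sat N v w r' \<and> sat N v w p)"
    using weakening_strong_negation[OF compact_S p' p] by metis
  let ?s = "sub id (\<lambda>i. Some (w i))"
  have ws: "weakening (?s r) (?s r')" "?s r \<in> forms c L"
    using r(1,2) by (auto simp: weakening_sub sub_in_forms)
  obtain q where q: "q \<in> H" "hvars q \<subseteq> hvars (?s r)"
    "\<And>v w. v ` hvars (?s r) \<subseteq> home U \<Longrightarrow>
      (sat U v w (?s r) \<longrightarrow> sat U v w q) \<and> (sat U v w q \<longrightarrow> sat U v w (?s r'))"
    using dense_moduloD[OF H ws(2) svars_sub_consts ws(1)] by metis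
  have hv: "hvars (?s r) = hvars p"
    using r(3) unfolding hvars_sub_consts .
  have "override_on v a X ` hvars p \<subseteq> home U"
    using a(1) v M by (auto simp: override_on_def)
  then have "sat U (override_on v a X) w (Neg q)"
    using q(3) r(5) a(2) unfolding hv sat.simps sat_sub_consts by blast
  moreover have "v ` (hvars q - X) \<subseteq> M"
    using v q(2) hv by blast
  ultimately obtain b where b: "b ` X \<subseteq> M" "sat U (override_on v b X) w (Neg q)"
    using tv_negationD[OF tv q(1) X _ a(1)] unfolding sat.simps by blast
  have "override_on v b X ` hvars p \<subseteq> home U"
    using b(1) v M by (auto simp: override_on_def)
  then have "\<not> sat U (override_on v b X) w r"
    using q(3) b(2) unfolding hv sat.simps sat_sub_consts by blast
  then show "\<exists>a. a ` X \<subseteq> M \<and> sat U (override_on v a X) w p'"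
    using b(1) r(4) by blast
qed

text \<open>The implications form a circle: (2) for H, (3) for all formulas of the class, (3) for H,
  (2) for all formulas, (2) for H.\<close>

lemma tv_conditions_dense:
  assumes H: "H \<subseteq> forms c L" "dense_modulo TYPE('u) L (positive_theory L U) (forms c L) H"
    and M: "M \<subseteq> home U"
  shows "tv_weakening U H M \<longleftrightarrow> tv_weakening U (forms c L) M"
    and "tv_negation U H M \<longleftrightarrow> tv_weakening U (forms c L) M"
    and "tv_weakening U (forms c L) M \<Longrightarrow> tv_negation U (forms c L) M"
proof -
  have sub: "tv_weakening U (forms c L) M \<Longrightarrow> tv_weakening U H M"
    "tv_negation U (forms c L) M \<Longrightarrow> tv_negation U H M"
    unfolding tv_weakening_def tv_negation_def
    by (rule ballI, erule bspec, erule subsetD[OF H(1)])+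
  note 1 = tv_negation_if_tv_weakening_dense[OF H M] tv_weakening_if_tv_negation_dense[OF H(2) M]
  show "tv_weakening U H M \<longleftrightarrow> tv_weakening U (forms c L) M"
    "tv_negation U H M \<longleftrightarrow> tv_weakening U (forms c L) M"
    "tv_weakening U (forms c L) M \<Longrightarrow> tv_negation U (forms c L) M"
    using sub 1 by blast+
qed

end

section \<open>Submodels\<close>

lemma sat_foldr_AllH:
  "sat N v w (foldr AllH xs p) \<longleftrightarrow>
   (\<forall>a. a ` set xs \<subseteq> home N \<longrightarrow> sat N (override_on v a (set xs)) w p)"
proof (induction xs arbitrary: v)
  case (Cons x xs)
  have "(\<forall>b\<in>home N. \<forall>a. a ` set xs \<subseteq> home N \<longrightarrow> sat N (override_on (v(x := b)) a (set xs)) w p)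
    \<longleftrightarrow> (\<forall>a. a ` set (x # xs) \<subseteq> home N \<longrightarrow> sat N (override_on v a (set (x # xs))) w p)"
    (is "?l \<longleftrightarrow> ?r")
  proof
    assume l: ?l
    show ?r
    proof (intro allI impI)
      fix a assume a: "a ` set (x # xs) \<subseteq> home N"
      have "override_on (v(x := a x)) a (set xs) = override_on v a (set (x # xs))"
        by (auto simp: override_on_def)
      then show "sat N (override_on v a (set (x # xs))) w p"
        using l[rule_format, of "a x" a] a by simp
    qed
  next
    assume r: ?r
    show ?l
    proof (intro ballI allI impI)
      fix b a assume ba: "b \<in> home N" "a ` set xs \<subseteq> home N"
      \<comment> \<open>If x occurs again in \<open>xs\<close>, the inner quantifier shadows the
        outer one, so \<open>b\<close> is used only outside \<open>set xs\<close>.\<close>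
      define a' where "a' = (\<lambda>i. if i \<in> set xs then a i else b)"
      have "override_on (v(x := b)) a (set xs) = override_on v a' (set (x # xs))"
        by (auto simp: override_on_def a'_def)
      moreover have "a' ` set (x # xs) \<subseteq> home N"
        using ba by (auto simp: a'_def)
      ultimately show "sat N (override_on (v(x := b)) a (set xs)) w p"
        using r by simp
    qed
  qed
  then show ?case
    by (simp only: foldr_Cons o_apply sat.simps Cons.IH)
qed simp

lemma foldr_AllH_in_forms: "foldr AllH xs p \<in> forms c L \<longleftrightarrow> p \<in> forms c L"
  by (induction xs) auto

lemma hvars_foldr_AllH: "hvars (foldr AllH xs p) = hvars p - set xs"
  by (induction xs) auto

lemma weakening_foldr_AllH: "weakening p p' \<Longrightarrow> weakening (foldr AllH xs p) (foldr AllH xs p')"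
  by (induction xs) (auto intro: weakening.AllH)

lemma heval_home_update: "heval (U\<lparr>home := M\<rparr>) v t = heval U v t"
  by (induction t) (auto cong: map_cong)

lemma seval_home_update: "seval (U\<lparr>home := M\<rparr>) v w t = seval U v w t"
  by (induction t) (auto simp: heval_home_update cong: map_cong)

lemma submodelD:
  assumes "submodel L U F M" "p \<in> F" "v ` hvars p \<subseteq> M" "sat (U\<lparr>home := M\<rparr>) v w p"
  shows "sat U v w p"
  using assms unfolding submodel_def by simp

text \<open>If \<open>p'\<close> fails at all tuples from M, the universal closure of its strong
  negation should pass from M to U and refute \<open>p\<close> at \<open>a\<close>. But the failure
  is known in U and not in the substructure. The second strong negation \<open>t\<close>, of
  \<open>r'\<close>, bridges this: if \<open>r'\<close> failed in the substructure, \<open>t\<close>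
  would hold there, hence in U, against \<open>r\<close>.\<close>

lemma tv_weakening_if_submodel:
  fixes U :: "('f, 'r, 'g, 's::t2_space, 'u) struct"
  assumes S: "compact (UNIV :: 's set)" and sub: "submodel L U (forms c L) M"
  shows "tv_weakening U (forms c L) M"
  unfolding tv_weakening_def
proof (intro ballI allI impI, elim conjE exE, rule ccontr)
  fix p X v w p' a
  assume p: "p \<in> forms c L" and X: "finite X" and v: "v ` (hvars p - X) \<subseteq> M"
    and p': "weakening p p'"
    and a: "a ` X \<subseteq> home U" "sat U (override_on v a X) w p"
    and none: "\<not> (\<exists>a. a ` X \<subseteq> M \<and> sat U (override_on v a X) w p')"
  obtain r r' where r: "weakening r r'" "r \<in> forms c L" "hvars r = hvars p"
    "\<And>(N :: ('f, 'r, 'g, 's, 'u) struct) v w. \<not> sat N v w p' \<Longrightarrow> sat N v w r"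
    "\<And>(N :: ('f, 'r, 'g, 's, 'u) struct) v w. \<not> (sat N v w r' \<and> sat N v w p)"
    using weakening_strong_negation[OF S p' p] by metis
  obtain t t' where t: "weakening t t'" "t \<in> forms c L" "hvars t = hvars r"
    "\<And>(N :: ('f, 'r, 'g, 's, 'u) struct) v w. \<not> sat N v w r' \<Longrightarrow> sat N v w t"
    "\<And>(N :: ('f, 'r, 'g, 's, 'u) struct) v w. \<not> (sat N v w t' \<and> sat N v w r)"
    using weakening_strong_negation[OF S r(1,2)] by metis
  obtain xs where xs: "set xs = X"
    using X finite_list by blast
  have "sat (U\<lparr>home := M\<rparr>) (override_on v b X) w r'" if b: "b ` X \<subseteq> M" for b
  proof (rule ccontr)
    assume "\<not> sat (U\<lparr>home := M\<rparr>) (override_on v b X) w r'"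
    then have "sat (U\<lparr>home := M\<rparr>) (override_on v b X) w t"
      by (rule t(4))
    moreover have "override_on v b X ` hvars t \<subseteq> M"
      using b v r(3) t(3) by (auto simp: override_on_def)
    ultimately have "sat U (override_on v b X) w t"
      using submodelD[OF sub t(2)] by blast
    then have "sat U (override_on v b X) w t'"
      by (rule weakening_imp[OF t(1)])
    moreover have "sat U (override_on v b X) w r"
      using none b r(4) by blast
    ultimately show False
      using t(5) by blast
  qed
  then have "sat (U\<lparr>home := M\<rparr>) v w (foldr AllH xs r')"
    by (simp add: sat_foldr_AllH xs)
  moreover have "foldr AllH xs r' \<in> forms c L"
    using weakening_in_forms[OF r(1,2)] by (simp add: foldr_AllH_in_forms)
  moreover have "v ` hvars (foldr AllH xs r') \<subseteq> M"
    using v r(3) weakening_hvars[OF r(1)] by (simp add: hvars_foldr_AllH xs)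
  ultimately have "sat U v w (foldr AllH xs r')"
    using submodelD[OF sub] by blast
  then have "sat U (override_on v a X) w r'"
    using a(1) by (simp add: sat_foldr_AllH xs)
  then show False
    using r(5) a(2) by blast
qed

lemma override_on_singleton: "override_on v a {i} = v(i := a i)"
  by (auto simp: override_on_def)

text \<open>Negated home formulas are atoms too, so condition (3) contains the classical
  Tarski--Vaught test for the home language and gives an elementary substructure in both
  directions.\<close>

lemma hsat_home_update_if_tv_negation:
  assumes tv: "tv_negation U (forms False L) M" and M: "M \<subseteq> home U"
  shows "wf_hform L p \<Longrightarrow> v ` hvars_hform p \<subseteq> M \<Longrightarrow> hsat (U\<lparr>home := M\<rparr>) v p \<longleftrightarrow> hsat U v p"
proof (induction p arbitrary: v)
  case (HRel R ts)
  then show ?case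
    by (simp add: heval_home_update cong: map_cong)
next
  case (HConj p q)
  then show ?case
    by (simp add: image_Un)
next
  case (HEx i p)
  have IH: "hsat (U\<lparr>home := M\<rparr>) (v(i := b)) p \<longleftrightarrow> hsat U (v(i := b)) p" if "b \<in> M" for b
    using HEx.prems that by (intro HEx.IH) auto
  have "\<exists>b\<in>M. hsat U (v(i := b)) p" if a: "a \<in> home U" "hsat U (v(i := a)) p" for a
  proof -
    have "\<exists>b. b ` {i} \<subseteq> M \<and> \<not> sat U (override_on v b {i}) undefined (RH (HNeg p))"
      using a HEx.prems
      by (intro tv_negationD[OF tv, where a = "\<lambda>_. a"]) (auto simp: override_on_singleton)
    then show ?thesis
      by (auto simp: override_on_singleton)
  qed
  then show ?case
    using IH M by auto
qed (auto simp: heval_home_update)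

text \<open>Apart from home atoms, only the universal home quantifier requires the hypothesis: a
  counterexample in U can be moved into M. Terms have the same values in both structures, and
  S-quantifiers range over the same S.\<close>

lemma submodel_if_tv_negation:
  assumes tv: "tv_negation U (forms c L) M" and M: "M \<subseteq> home U" and cl: "hclosed L U M"
  shows "submodel L U (forms c L) M"
proof -
  have "sat U v w p" if "p \<in> forms c L" "v ` hvars p \<subseteq> M" "sat (U\<lparr>home := M\<rparr>) v w p" for p v w
    using that
  proof (induction p arbitrary: v w)
    case (RH h)
    then show ?case
      using hsat_home_update_if_tv_negation[of U L M h v] tv M by simp
  next
    case (SIn ts C)
    then show ?case
      by (simp add: seval_home_update cong: map_cong)
  next
    case (Conj p q)
    then show ?case
      by (simp add: image_Un)
  next
    case (Disj p q)
    then show ?case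
      by (auto simp: image_Un)
  next
    case (AllH i p)
    have IH: "sat U (v(i := b)) w p" if b: "b \<in> M" for b
    proof (rule AllH.IH)
      show "sat (U\<lparr>home := M\<rparr>) (v(i := b)) w p"
        using AllH.prems(3) b by simp
    qed (use AllH.prems b in auto)
    show ?case
    proof (rule ccontr)
      assume "\<not> ?case"
      then obtain a where a: "a \<in> home U" "\<not> sat U (v(i := a)) w p"
        by auto
      then have "\<exists>b. b ` {i} \<subseteq> M \<and> \<not> sat U (override_on v b {i}) w p"
        using AllH.prems
        by (intro tv_negationD[OF tv, where a = "\<lambda>_. a"]) (auto simp: override_on_singleton)
      then show False
        using IH by (auto simp: override_on_singleton)
    qed
  next
    case (ExH i p)
    then obtain b where b: "b \<in> M" "sat (U\<lparr>home := M\<rparr>) (v(i := b)) w p"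
      by auto
    have "(v(i := b)) ` hvars p \<subseteq> M" "p \<in> forms c L"
      using ExH.prems(1,2) b(1) by auto
    then have "sat U (v(i := b)) w p"
      using ExH.IH b(2) by blast
    then show ?case
      using b M by auto
  next
    case (AllS i p)
    have "sat U v (w(i := s)) p" for s
      using AllS.IH AllS.prems unfolding sat.simps forms_simps hvars.simps by blast
    then show ?case
      by simp
  next
    case (ExS i p)
    then obtain s where "sat (U\<lparr>home := M\<rparr>) v (w(i := s)) p"
      by auto
    then have "sat U v (w(i := s)) p"
      using ExS.IH ExS.prems(1,2) unfolding forms_simps hvars.simps by blast
    then show ?case
      by auto
  qed simp
  then show ?thesis
    using M cl by (simp add: submodel_def)
qed

lemma heval_HApp_vars:
  assumes "length xs = n" "\<And>i. i < n \<Longrightarrow> v i = xs ! i"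
  shows "heval N v (HApp f (map HVar [0..<n])) = hfun N f xs"
proof -
  have "map (heval N v) (map HVar [0..<n]) = xs"
    using assms by (intro nth_equalityI) auto
  then show ?thesis
    by (simp only: heval.simps)
qed

text \<open>The home formula saying that y differs from f(x) fails in U only at y = f(x), so
  condition (3) forces this value into M.\<close>

lemma hclosed_if_tv_negation:
  assumes tv: "tv_negation U (forms False L) M" and M: "M \<subseteq> home U"
    and U: "standard_structure L U"
  shows "hclosed L U M"
  unfolding hclosed_def
proof (intro allI impI, elim conjE)
  fix f n xs
  assume f: "hfun_arity L f = Some n" "length xs = n" "set xs \<subseteq> M"
  \<comment> \<open>Variables below \<open>n\<close> hold the arguments; variable \<open>n\<close>
    is fresh and stands for the value.\<close>
  define t where "t = HApp f (map HVar [0..<n])"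
  define v where "v = (\<lambda>i. xs ! i)"
  have ev: "heval U (v(n := b)) t = hfun U f xs" for b
    unfolding t_def by (rule heval_HApp_vars) (auto simp: f(2) v_def)
  have vars: "v ` (hvars_hterm t - {n}) \<subseteq> M"
    using f by (auto simp: t_def v_def)
  have wf: "wf_hterm L t"
    using f(1) by (simp add: t_def)
  have home: "hfun U f xs \<in> home U"
    using U f M unfolding standard_structure_def hclosed_def by blast
  have "\<exists>b. b ` {n} \<subseteq> M \<and>
      \<not> sat U (override_on v b {n}) undefined (RH (HNeg (HEq (HVar n) t)))"
    using home wf vars
    by (intro tv_negationD[OF tv, where a = "\<lambda>_. hfun U f xs"])
      (auto simp: override_on_singleton ev)
  then show "hfun U f xs \<in> M"
    by (auto simp: override_on_singleton ev)
qed

section \<open>Cauchy completion\<close>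

lemma plug_empty: "plug v Map.empty = v"
  by (simp add: plug_def)

abbreviation pairs :: "('s \<times> 's) set \<Rightarrow> (nat \<Rightarrow> 's) set" where
  "pairs D \<equiv> (\<lambda>(a, b). tuple [a, b]) ` D"

lemma sim_refl: "(\<tau>, D) \<in> sim_indices L \<Longrightarrow> sim U \<tau> D a a"
  using compact_nbhd_subset by (fastforce simp: sim_def sim_indices_def)

lemma subset_Ccl:
  assumes "M \<subseteq> home U"
  shows "M \<subseteq> Ccl L U M"
proof
  fix a assume a: "a \<in> M"
  have "\<forall>(\<tau>, D)\<in>I. sim U \<tau> D a a" if "I \<subseteq> sim_indices L" for I
    using that sim_refl by fast
  then show "a \<in> Ccl L U M"
    using a assms unfolding Ccl_def by blast
qed

lemma Ccl_subset_home: "Ccl L U M \<subseteq> home U"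
  by (auto simp: Ccl_def)

text \<open>
  The formula \<open>\<forall>z. \<langle>t(a,z), t(b,z)\<rangle> \<in> C\<close>, where the variables \<open>z\<close> of \<open>t\<close> are shifted by \<open>K\<close> to keep
  them apart from those of the home terms \<open>a\<close> and \<open>b\<close>.
\<close>

definition close_form ::
  "nat \<Rightarrow> 'f hterm \<Rightarrow> 'f hterm \<Rightarrow> ('f, 'g, 's) sterm \<Rightarrow> (nat \<Rightarrow> 's) set \<Rightarrow> ('f, 'r, 'g, 's) form"
  where
  "close_form K a b t C =
     foldr AllH (sorted_list_of_set ((\<lambda>i. i + K) ` hvars_sterm t))
       (SIn [sub_term (\<lambda>i. if i = 0 then a else HVar (i + K)) Map.empty t,
             sub_term (\<lambda>i. if i = 0 then b else HVar (i + K)) Map.empty t] C)"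

lemma close_form_in_forms:
  assumes "wf_sterm L t" "wf_hterm L a" "wf_hterm L b" "compactin (spow 2) C"
  shows "close_form K a b t C \<in> forms c L"
  unfolding close_form_def foldr_AllH_in_forms
  using assms by (auto simp: numeral_2_eq_2 intro!: wf_sub_term)

lemma hvars_close_form: "hvars (close_form K a b t C) \<subseteq> hvars_hterm a \<union> hvars_hterm b"
  unfolding close_form_def hvars_foldr_AllH
  using finite_hvars_sterm[of t] by (auto simp: hvars_sub_term split: if_splits)

lemma weakening_close_form:
  "compact_nbhd (spow 2) C' C \<Longrightarrow> weakening (close_form K a b t C) (close_form K a b t C')"
  unfolding close_form_def
  by (intro weakening_foldr_AllH weakening.SIn) (simp add: numeral_2_eq_2)

text \<open>This makes \<open>sim\<close> a continuous condition. Since the variables of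
  \<open>a\<close> and \<open>b\<close> are below K, the shifted bound variables capture none of
  them. The formula quantifies over finitely many variables and \<open>sim\<close> over whole
  valuations, hence the translation between \<open>y\<close> and \<open>z\<close>.\<close>

lemma sat_close_form:
  assumes t: "svars_sterm t = {}" and K: "hvars_hterm a \<subseteq> {..<K}" "hvars_hterm b \<subseteq> {..<K}"
    and "home U \<noteq> {}"
  shows "sat U v w (close_form K a b t (pairs D)) \<longleftrightarrow> sim U [t] D (heval U v a) (heval U v b)"
proof -
  define X where "X = (\<lambda>i. i + K) ` hvars_sterm t"
  have X: "set (sorted_list_of_set X) = X"
    using finite_hvars_sterm[of t] by (simp add: X_def)
  obtain h where h: "h \<in> home U"
    using assms(4) by blast
  \<comment> \<open>The value of \<open>t\<close> with the home term \<open>s\<close> in place of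
    variable 0 and the shifted variables read from \<open>y\<close>.\<close>
  define E where "E = (\<lambda>s y. seval U (\<lambda>i. heval U (override_on v y X)
      (if i = 0 then s else HVar (i + K))) w t)"
  have E: "E s y = seval U (z(0 := heval U v s)) w' t"
    if s: "hvars_hterm s \<subseteq> {..<K}" and z: "\<And>i. i \<in> hvars_sterm t \<Longrightarrow> z i = y (i + K)"
    for s y z w'
    unfolding E_def
  proof (rule seval_cong)
    fix i assume i: "i \<in> hvars_sterm t"
    have "heval U (override_on v y X) s = heval U v s"
      using s by (intro heval_cong) (auto simp: X_def override_on_def)
    then show "heval U (override_on v y X) (if i = 0 then s else HVar (i + K)) =
        (z(0 := heval U v s)) i"
      using i z[OF i] by (auto simp: X_def override_on_def)
  qed (use t in auto)
  have "sat U v w (close_form K a b t (pairs D)) \<longleftrightarrow>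
      (\<forall>y. y ` X \<subseteq> home U \<longrightarrow> (E a y, E b y) \<in> D)"
    unfolding close_form_def X_def[symmetric] sat_foldr_AllH X
    by (simp add: tuple2_in_image_iff seval_sub_term plug_def E_def)
  also have "\<dots> \<longleftrightarrow> sim U [t] D (heval U v a) (heval U v b)" (is "?l \<longleftrightarrow> ?r")
  proof
    assume l: ?l
    have "(seval U (z(0 := heval U v a)) w' t, seval U (z(0 := heval U v b)) w' t) \<in> D"
      if z: "range z \<subseteq> home U" for z w'
    proof -
      define y where "y = (\<lambda>i. z (i - K))"
      have "y ` X \<subseteq> home U"
        using z by (auto simp: y_def)
      moreover have "E a y = seval U (z(0 := heval U v a)) w' t"
        "E b y = seval U (z(0 := heval U v b)) w' t"
        using K by (auto intro!: E simp: y_def)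
      ultimately show ?thesis
        using l by metis
    qed
    then show ?r
      by (simp add: sim_def)
  next
    assume r: ?r
    show ?l
    proof (intro allI impI)
      fix y assume y: "y ` X \<subseteq> home U"
      define z where "z = (\<lambda>i. if i \<in> hvars_sterm t then y (i + K) else h)"
      have "range z \<subseteq> home U"
        using y h by (auto simp: z_def X_def)
      moreover have "E a y = seval U (z(0 := heval U v a)) w t"
        "E b y = seval U (z(0 := heval U v b)) w t"
        using K by (auto intro!: E simp: z_def)
      ultimately show "(E a y, E b y) \<in> D"
        using r by (simp add: sim_def)
    qed
  qed
  finally show ?thesis .
qed

section \<open>Indistinguishable elements and uniform transfer of continuous formulas\<close>

definition indist ::
  "('f, 'r, 'g) lang \<Rightarrow> ('f, 'r, 'g, 's::t2_space, 'u) struct \<Rightarrow> 'u \<Rightarrow> 'u \<Rightarrow> bool" where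
  "indist L U a b \<longleftrightarrow> (\<forall>(\<tau>, D)\<in>sim_indices L. sim U \<tau> D a b)"

lemma indist_refl: "indist L U a a"
  by (auto simp: indist_def sim_refl)

lemma indistI:
  assumes "\<And>t D. wf_sterm L t \<Longrightarrow> svars_sterm t = {} \<Longrightarrow> compact_nbhd euclidean D Id \<Longrightarrow>
    sim U [t] D a b"
  shows "indist L U a b"
  using assms unfolding indist_def sim_indices_def sim_def by auto

context saturated_structure
begin

text \<open>Replacing the \<open>S\<close>-variables by constants turns every term into one that \<open>\<sim>\<close> tests.\<close>

lemma seval_eq_if_indist1:
  assumes ab: "indist L U a b" and t: "wf_sterm L t" and v: "range v \<subseteq> home U"
  shows "seval U (v(i := a)) w t = seval U (v(i := b)) w t"
proof (rule eq_if_in_all_compact_nbhds_Id[OF compact_S])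
  fix D :: "('s \<times> 's) set" assume D: "compact_nbhd euclidean D Id"
  \<comment> \<open>The transposition of 0 and \<open>i\<close>: the relations \<open>sim\<close>
    test terms only at variable 0.\<close>
  define f where "f = (\<lambda>k :: nat. if k = i then 0 else if k = 0 then i else k)"
  define t' where "t' = sub_term (\<lambda>k. HVar (f k)) (\<lambda>k. Some (w k)) t"
  have "svars_sterm t' = {}" "wf_sterm L t'"
    using t by (auto simp: t'_def svars_sub_term wf_sub_term)
  then have "sim U [t'] D a b"
    using ab D by (auto simp: indist_def sim_indices_def)
  moreover have "range (v \<circ> f) \<subseteq> home U"
    using v by auto
  ultimately have "(seval U ((v \<circ> f)(0 := a)) w t', seval U ((v \<circ> f)(0 := b)) w t') \<in> D"
    by (simp add: sim_def del: comp_apply fun_upd_apply)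
  moreover have "seval U ((v \<circ> f)(0 := x)) w t' = seval U (v(i := x)) w t" for x
    unfolding t'_def seval_sub_term by (rule seval_cong) (auto simp: f_def plug_def)
  ultimately show "(seval U (v(i := a)) w t, seval U (v(i := b)) w t) \<in> D"
    by simp
qed

text \<open>Only finitely many variables occur in \<open>t\<close>, so their values can be exchanged
  one at a time.\<close>

lemma seval_eq_if_indist:
  assumes u: "\<And>i. indist L U (u i) (u' i)" "range u \<subseteq> home U" "range u' \<subseteq> home U"
    and t: "wf_sterm L t"
  shows "seval U u w t = seval U u' w t"
proof -
  have "seval U (override_on u u' Z) w t = seval U u w t" if "finite Z" for Z
    using that
  proof (induction Z rule: finite_induct)
    case (insert i Z)
    let ?v = "override_on u u' Z"
    have "range ?v \<subseteq> home U"
      using u(2,3) by (auto simp: override_on_def)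
    then have "seval U (?v(i := u i)) w t = seval U (?v(i := u' i)) w t"
      by (rule seval_eq_if_indist1[OF u(1) t])
    moreover have "?v(i := u i) = ?v" "?v(i := u' i) = override_on u u' (insert i Z)"
      using insert.hyps(2) by (auto simp: override_on_def)
    ultimately show ?case
      using insert.IH by simp
  qed simp
  moreover have "seval U (override_on u u' (hvars_sterm t)) w t = seval U u' w t"
    by (rule seval_cong) auto
  ultimately show ?thesis
    using finite_hvars_sterm by metis
qed

text \<open>A bound variable receives the same value on both sides, so reflexivity preserves the
  hypothesis under quantifiers. Home atoms are excluded, as home equality can separate
  indistinguishable elements.\<close>

lemma sat_iff_if_indist:
  assumes "p \<in> forms True L" "\<And>i. indist L U (u i) (u' i)" "range u \<subseteq> home U" "range u' \<subseteq> home U"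
  shows "sat U u w p \<longleftrightarrow> sat U u' w p"
  using assms
proof (induction p arbitrary: u u' w)
  case (SIn ts C)
  then have "map (seval U u w) ts = map (seval U u' w) ts"
    by (auto intro!: seval_eq_if_indist)
  then show ?case
    by (simp only: sat.simps)
next
  case (Conj p q)
  then show ?case
    unfolding sat.simps forms_simps by blast
next
  case (Disj p q)
  then show ?case
    unfolding sat.simps forms_simps by blast
next
  case (AllH i p)
  have "sat U (u(i := a)) w p \<longleftrightarrow> sat U (u'(i := a)) w p" if "a \<in> home U" for a
  proof -
    have "indist L U ((u(i := a)) k) ((u'(i := a)) k)" for k
      using AllH.prems(2) by (simp add: indist_refl)
    moreover have "range (u(i := a)) \<subseteq> home U" "range (u'(i := a)) \<subseteq> home U" "p \<in> forms True L"
      using AllH.prems that by auto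
    ultimately show ?thesis
      using AllH.IH by blast
  qed
  then show ?case
    unfolding sat.simps by blast
next
  case (ExH i p)
  have "sat U (u(i := a)) w p \<longleftrightarrow> sat U (u'(i := a)) w p" if "a \<in> home U" for a
  proof -
    have "indist L U ((u(i := a)) k) ((u'(i := a)) k)" for k
      using ExH.prems(2) by (simp add: indist_refl)
    moreover have "range (u(i := a)) \<subseteq> home U" "range (u'(i := a)) \<subseteq> home U" "p \<in> forms True L"
      using ExH.prems that by auto
    ultimately show ?thesis
      using ExH.IH by blast
  qed
  then show ?case
    unfolding sat.simps by blast
next
  case (AllS i p)
  then show ?case
    unfolding sat.simps forms_simps by blast
next
  case (ExS i p)
  then show ?case
    unfolding sat.simps forms_simps by blast
qed simp_all

text \<open>Compactness turns \<open>sat_iff_if_indist\<close> into a finite statement. If no finite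
  I sufficed, saturation would give indistinguishable tuples of which one satisfies \<open>p\<close>
  and the other a strong negation of \<open>p'\<close>.\<close>

lemma sim_uniform:
  assumes p: "p \<in> forms True L" "weakening p p'"
  obtains I where "finite I" "I \<subseteq> sim_indices L"
    "\<And>u u' w. u ` hvars p \<subseteq> home U \<Longrightarrow> u' ` hvars p \<subseteq> home U \<Longrightarrow>
      (\<And>i \<tau> D. i \<in> hvars p \<Longrightarrow> (\<tau>, D) \<in> I \<Longrightarrow> sim U \<tau> D (u i) (u' i)) \<Longrightarrow>
      sat U u w p \<Longrightarrow> sat U u' w p'"
proof -
  define good where "good = (\<lambda>I. \<forall>u u' w. u ` hvars p \<subseteq> home U \<longrightarrow> u' ` hvars p \<subseteq> home U \<longrightarrow>
      (\<forall>i \<tau> D. i \<in> hvars p \<longrightarrow> (\<tau>, D) \<in> I \<longrightarrow> sim U \<tau> D (u i) (u' i)) \<longrightarrow>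
      sat U u w p \<longrightarrow> sat U u' w p')"
  have "\<exists>I. finite I \<and> I \<subseteq> sim_indices L \<and> good I"
  proof (rule ccontr)
    assume contra: "\<not> ?thesis"
    obtain q q' where q: "weakening q q'" "q \<in> forms True L" "hvars q = hvars p"
      "\<And>(N :: ('f, 'r, 'g, 's, 'u) struct) v w. \<not> sat N v w p' \<Longrightarrow> sat N v w q"
      "\<And>(N :: ('f, 'r, 'g, 's, 'u) struct) v w. \<not> (sat N v w q' \<and> sat N v w p)"
      using weakening_strong_negation[OF compact_S p(2,1)] by metis
    obtain h where h: "h \<in> home U"
      using infinite_home by fastforce
    \<comment> \<open>Two disjoint copies of the variables in one valuation: even numbers carry
      \<open>u\<close>, odd numbers carry \<open>u'\<close>.\<close>
    define f0 f1 where "f0 = (\<lambda>i :: nat. 2 * i)" and "f1 = (\<lambda>i :: nat. 2 * i + 1)"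
    have inj: "inj f0" "inj f1"
      by (auto simp: inj_def f0_def f1_def)
    define p0 q1 where "p0 = sub f0 Map.empty p" and "q1 = sub f1 Map.empty q"
    have sat01: "sat U v w p0 \<longleftrightarrow> sat U (v \<circ> f0) w p" "sat U v w q1 \<longleftrightarrow> sat U (v \<circ> f1) w q" for v w
      by (simp_all add: p0_def q1_def sat_sub inj plug_empty del: o_apply)
    define A :: "(nat \<times> ('f, 'g, 's) sterm \<times> ('s \<times> 's) set) set" where
      "A = {(i, t, D). i \<in> hvars p \<and> wf_sterm L t \<and> svars_sterm t = {} \<and>
        compact_nbhd euclidean D Id}"
    \<comment> \<open>The shift 2 * i + 2 is the first number above both \<open>f0 i\<close> and
      \<open>f1 i\<close>.\<close>
    define g :: "nat \<times> ('f, 'g, 's) sterm \<times> ('s \<times> 's) set \<Rightarrow> ('f, 'r, 'g, 's) form" where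
      "g = (\<lambda>(i, t, D). close_form (2 * i + 2) (HVar (f0 i)) (HVar (f1 i)) t (pairs D))"
    have sat_g: "sat U v w (g (i, t, D)) \<longleftrightarrow> sim U [t] D (v (f0 i)) (v (f1 i))"
      if "(i, t, D) \<in> A" for v w i t D
      using that h sat_close_form[of t "HVar (f0 i)" "2 * i + 2" "HVar (f1 i)" U v w D]
      by (auto simp: A_def g_def f0_def f1_def)
    define P where "P = (\<lambda>x. (x, Map.empty :: nat \<rightharpoonup> 'u)) ` ({p0, q1} \<union> g ` A)"
    have "realized_in U P"
    proof (rule realized_in_if_finitely_realized[where A = "{}"])
      show "x \<in> positive_forms L \<and> ran e \<subseteq> {}" if "(x, e) \<in> P" for x e
      proof -
        have "g y \<in> forms True L" if "y \<in> A" for y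
          using that compactin_image_tuple2
          by (auto simp: A_def g_def compact_nbhd_def intro!: close_form_in_forms)
        moreover have "p0 \<in> forms True L" "q1 \<in> forms True L"
          using p(1) q(2) by (auto simp: p0_def q1_def sub_in_forms)
        ultimately have "x \<in> forms True L" "e = Map.empty"
          using that unfolding P_def by blast+
        then show ?thesis
          by (simp add: forms_imp_positive_forms)
      qed
    next
      fix Q assume Q: "finite Q" "Q \<subseteq> P"
      then obtain R where R: "R \<subseteq> {p0, q1} \<union> g ` A" "finite R" "Q = (\<lambda>x. (x, Map.empty)) ` R"
        unfolding P_def using finite_subset_image by metis
      have "finite (R - {p0, q1})" "R - {p0, q1} \<subseteq> g ` A"
        using R by auto
      then obtain B where B: "B \<subseteq> A" "finite B" "R - {p0, q1} = g ` B"
        using finite_subset_image by metis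
      define I where "I = (\<lambda>(i, t, D). ([t], D)) ` B"
      have "finite I" "I \<subseteq> sim_indices L"
        using B by (auto simp: I_def A_def sim_indices_def)
      then have "\<not> good I"
        using contra by blast
      then obtain u u' w where u: "u ` hvars p \<subseteq> home U" "u' ` hvars p \<subseteq> home U"
        "\<And>i \<tau> D. i \<in> hvars p \<Longrightarrow> (\<tau>, D) \<in> I \<Longrightarrow> sim U \<tau> D (u i) (u' i)"
        "sat U u w p" "\<not> sat U u' w p'"
        unfolding good_def by blast
      define v where "v = (\<lambda>n. if n div 2 \<in> hvars p then if even n then u (n div 2) else u' (n div 2)
        else h)"
      have v: "range v \<subseteq> home U"
        using u(1,2) h by (auto simp: v_def)
      have vi: "v (f0 i) = u i" "v (f1 i) = u' i" if "i \<in> hvars p" for i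
        using that by (auto simp: v_def f0_def f1_def)
      have "sat U (v \<circ> f0) w p \<longleftrightarrow> sat U u w p" "sat U (v \<circ> f1) w q \<longleftrightarrow> sat U u' w q"
        by (rule sat_cong; use vi q(3) in simp)+
      then have "sat U v w p0" "sat U v w q1"
        using sat01 u(4) q(4)[OF u(5)] by auto
      moreover have "sat U v w (g y)" if yB: "y \<in> B" for y
      proof -
        obtain i t D where y: "y = (i, t, D)" "(i, t, D) \<in> A"
          using yB B(1) by (cases y) auto
        then have i: "i \<in> hvars p"
          by (auto simp: A_def)
        have "([t], D) \<in> I"
          using yB y(1) by (force simp: I_def)
        then show ?thesis
          unfolding y(1) sat_g[OF y(2)] vi[OF i] using u(3) i by blast
      qed
      moreover have "x = p0 \<or> x = q1 \<or> (\<exists>y\<in>B. x = g y)" if "x \<in> R" for x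
        using that B(3) by (cases "x \<in> {p0, q1}") auto
      ultimately have "sat U v w x" if "x \<in> R" for x
        using that by metis
      then show "realized_in U Q"
        unfolding realized_in_def R(3) using v by (auto simp: plug_empty)
    qed auto
    then obtain v w where v: "range v \<subseteq> home U" "\<forall>(x, e)\<in>P. sat U (plug v e) w x"
      unfolding realized_in_def by blast
    have sat: "sat U v w x" if "x \<in> {p0, q1} \<union> g ` A" for x
    proof -
      have "(x, Map.empty) \<in> P"
        using that unfolding P_def by (rule imageI)
      from bspec[OF v(2) this] show ?thesis
        by (simp add: plug_empty)
    qed
    \<comment> \<open>The type relates the two copies only at variables of \<open>p\<close>;
      elsewhere \<open>u'\<close> is made equal to \<open>u\<close>, so that the values are
      indistinguishable at every variable.\<close>
    define u u' where "u = v \<circ> f0" and "u' = override_on u (v \<circ> f1) (hvars p)"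
    have home: "range u \<subseteq> home U" "range u' \<subseteq> home U"
      using v(1) by (auto simp: u_def u'_def override_on_def)
    have "indist L U (u i) (u' i)" for i
    proof (cases "i \<in> hvars p")
      case True
      show ?thesis
      proof (rule indistI)
        fix t :: "('f, 'g, 's) sterm" and D :: "('s \<times> 's) set"
        assume "wf_sterm L t" "svars_sterm t = {}" "compact_nbhd euclidean D Id"
        then have "(i, t, D) \<in> A"
          using True by (auto simp: A_def)
        then have "sim U [t] D (v (f0 i)) (v (f1 i))"
          using sat sat_g by blast
        then show "sim U [t] D (u i) (u' i)"
          using True by (simp add: u_def u'_def)
      qed
    qed (simp add: u'_def indist_refl)
    then have "sat U u w p \<longleftrightarrow> sat U u' w p"
      using sat_iff_if_indist[OF p(1)] home by blast
    then have "sat U u' w p"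
      using sat[of p0] sat01(1) by (simp add: u_def)
    moreover have "sat U u' w q \<longleftrightarrow> sat U (v \<circ> f1) w q"
      by (rule sat_cong) (auto simp: u'_def q(3))
    then have "sat U u' w q"
      using sat[of q1] sat01(2) by simp
    then have "sat U u' w q'"
      by (rule weakening_imp[OF q(1)])
    ultimately show False
      using q(5) by blast
  qed
  then show thesis
    using that unfolding good_def by blast
qed

end

section \<open>Passage between M and its Cauchy completion\<close>

context saturated_structure
begin

lemma Ccl_approx:
  assumes "a \<in> Ccl L U M" "finite I" "I \<subseteq> sim_indices L"
  obtains b where "b \<in> M" "\<And>\<tau> D. (\<tau>, D) \<in> I \<Longrightarrow> sim U \<tau> D a b"
proof -
  have "\<exists>b\<in>M. \<forall>(\<tau>, D)\<in>I. sim U \<tau> D a b"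
    using assms unfolding Ccl_def by simp
  then show thesis
    using that by fast
qed

text \<open>The parameters lie in M and stay fixed. Witnesses for \<open>p1\<close> in Ccl M are
  approximated in M closely enough for \<open>sim_uniform\<close> to yield
  \<open>p'\<close>.\<close>

lemma tv_weakening_if_tv_weakening_Ccl:
  assumes M: "M \<subseteq> home U" and tv: "tv_weakening U (forms True L) (Ccl L U M)"
  shows "tv_weakening U (forms True L) M"
  unfolding tv_weakening_def
proof (intro ballI allI impI, elim conjE exE)
  fix p X v w p' a
  assume p: "p \<in> forms True L" and X: "finite X" and v: "v ` (hvars p - X) \<subseteq> M"
    and p': "weakening p p'"
    and a: "a ` X \<subseteq> home U" "sat U (override_on v a X) w p"
  obtain p1 where p1: "weakening p p1" "weakening p1 p'"
    using weakening_interpolate[OF compact_S p' p] by blast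
  have p1F: "p1 \<in> forms True L" and p1v: "hvars p1 = hvars p"
    using weakening_in_forms[OF p1(1) p] weakening_hvars[OF p1(1)] by auto
  have "v ` (hvars p - X) \<subseteq> Ccl L U M"
    using v subset_Ccl[OF M] by blast
  then obtain b where b: "b ` X \<subseteq> Ccl L U M" "sat U (override_on v b X) w p1"
    using tv_weakeningD[OF tv p X _ a p1(1)] by blast
  obtain I where I: "finite I" "I \<subseteq> sim_indices L"
    "\<And>u u' w. u ` hvars p1 \<subseteq> home U \<Longrightarrow> u' ` hvars p1 \<subseteq> home U \<Longrightarrow>
      (\<And>i \<tau> D. i \<in> hvars p1 \<Longrightarrow> (\<tau>, D) \<in> I \<Longrightarrow> sim U \<tau> D (u i) (u' i)) \<Longrightarrow>
      sat U u w p1 \<Longrightarrow> sat U u' w p'"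
    using sim_uniform[OF p1F p1(2)] by metis
  have "\<exists>c. c \<in> M \<and> (\<forall>\<tau> D. (\<tau>, D) \<in> I \<longrightarrow> sim U \<tau> D (b i) c)" if "i \<in> X" for i
  proof -
    have "b i \<in> Ccl L U M"
      using b(1) that by blast
    from Ccl_approx[OF this I(1,2)] show ?thesis
      by metis
  qed
  then obtain c where c: "\<And>i. i \<in> X \<Longrightarrow> c i \<in> M"
    "\<And>i \<tau> D. i \<in> X \<Longrightarrow> (\<tau>, D) \<in> I \<Longrightarrow> sim U \<tau> D (b i) (c i)"
    by metis
  have "sat U (override_on v c X) w p'"
  proof (rule I(3)[OF _ _ _ b(2)])
    show "override_on v b X ` hvars p1 \<subseteq> home U" "override_on v c X ` hvars p1 \<subseteq> home U"
      using v b(1) c(1) M Ccl_subset_home[of L U M] p1v by (auto simp: override_on_def)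
    show "sim U \<tau> D (override_on v b X i) (override_on v c X i)" if "(\<tau>, D) \<in> I" for i \<tau> D
      using c(2)[of i \<tau> D] that I(2) sim_refl[of \<tau> D L U "v i"] by (cases "i \<in> X") auto
  qed
  then show "\<exists>a. a ` X \<subseteq> M \<and> sat U (override_on v a X) w p'"
    using c(1) by blast
qed

text \<open>Now the parameters must be moved, from \<open>v\<close> in Ccl M to \<open>e\<close> in
  M and back. As D need not be symmetric, neither need \<open>sim\<close>; the way back is therefore
  by contraposition, moving a strong negation of \<open>p'\<close> from \<open>v\<close> to
  \<open>e\<close>.\<close>

lemma tv_weakening_Ccl_if_tv_weakening:
  assumes M: "M \<subseteq> home U" and tv: "tv_weakening U (forms True L) M"
  shows "tv_weakening U (forms True L) (Ccl L U M)"
  unfolding tv_weakening_def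
proof (intro ballI allI impI, elim conjE exE)
  fix p X v w p' a
  assume p: "p \<in> forms True L" and X: "finite X" and v: "v ` (hvars p - X) \<subseteq> Ccl L U M"
    and p': "weakening p p'"
    and a: "a ` X \<subseteq> home U" "sat U (override_on v a X) w p"
  obtain p1 where p1: "weakening p p1" "weakening p1 p'"
    using weakening_interpolate[OF compact_S p' p] by blast
  have p1F: "p1 \<in> forms True L" and p1v: "hvars p1 = hvars p"
    using weakening_in_forms[OF p1(1) p] weakening_hvars[OF p1(1)] by auto
  \<comment> \<open>Three losses are planned: \<open>p\<close> to \<open>p1\<close> for moving the
    parameters to M, \<open>p1\<close> to \<open>p2\<close> for the Tarski--Vaught condition,
    \<open>p2\<close> to \<open>p'\<close> for moving back.\<close>
  obtain p2 where p2: "weakening p1 p2" "weakening p2 p'"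
    using weakening_interpolate[OF compact_S p1(2) p1F] by blast
  have p2F: "p2 \<in> forms True L" and p2v: "hvars p2 = hvars p"
    using weakening_in_forms[OF p2(1) p1F] weakening_hvars[OF p2(1)] p1v by auto
  obtain r r' where r: "weakening r r'" "r \<in> forms True L" "hvars r = hvars p2"
    "\<And>(N :: ('f, 'r, 'g, 's, 'u) struct) v w. \<not> sat N v w p' \<Longrightarrow> sat N v w r"
    "\<And>(N :: ('f, 'r, 'g, 's, 'u) struct) v w. \<not> (sat N v w r' \<and> sat N v w p2)"
    using weakening_strong_negation[OF compact_S p2(2) p2F] by metis
  have rv: "hvars r = hvars p"
    using r(3) p2v by simp
  obtain I where I: "finite I" "I \<subseteq> sim_indices L"
    "\<And>u u' w. u ` hvars p \<subseteq> home U \<Longrightarrow> u' ` hvars p \<subseteq> home U \<Longrightarrow>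
      (\<And>i \<tau> D. i \<in> hvars p \<Longrightarrow> (\<tau>, D) \<in> I \<Longrightarrow> sim U \<tau> D (u i) (u' i)) \<Longrightarrow>
      sat U u w p \<Longrightarrow> sat U u' w p1"
    using sim_uniform[OF p p1(1)] by metis
  obtain J where J: "finite J" "J \<subseteq> sim_indices L"
    "\<And>u u' w. u ` hvars r \<subseteq> home U \<Longrightarrow> u' ` hvars r \<subseteq> home U \<Longrightarrow>
      (\<And>i \<tau> D. i \<in> hvars r \<Longrightarrow> (\<tau>, D) \<in> J \<Longrightarrow> sim U \<tau> D (u i) (u' i)) \<Longrightarrow>
      sat U u w r \<Longrightarrow> sat U u' w r'"
    using sim_uniform[OF r(2,1)] by metis
  have IJ: "finite (I \<union> J)" "I \<union> J \<subseteq> sim_indices L"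
    using I J by auto
  have "\<exists>c. c \<in> M \<and> (\<forall>\<tau> D. (\<tau>, D) \<in> I \<union> J \<longrightarrow> sim U \<tau> D (v i) c)" if "i \<in> hvars p - X" for i
  proof -
    have "v i \<in> Ccl L U M"
      using v that by blast
    from Ccl_approx[OF this IJ] show ?thesis
      by metis
  qed
  then obtain e where e: "\<And>i. i \<in> hvars p - X \<Longrightarrow> e i \<in> M"
    "\<And>i \<tau> D. i \<in> hvars p - X \<Longrightarrow> (\<tau>, D) \<in> I \<union> J \<Longrightarrow> sim U \<tau> D (v i) (e i)"
    by metis
  have home: "override_on v b X ` hvars p \<subseteq> home U" "override_on e b X ` hvars p \<subseteq> home U"
    if "b ` X \<subseteq> home U" for b
    using v e(1) that M Ccl_subset_home[of L U M] by (auto simp: override_on_def)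
  have sim: "sim U \<tau> D (override_on v b X i) (override_on e b X i)"
    if "i \<in> hvars p" "(\<tau>, D) \<in> I \<union> J" for b i \<tau> D
    using that e(2)[of i \<tau> D] IJ(2) sim_refl[of \<tau> D L U "b i"] by (cases "i \<in> X") auto
  have "sat U (override_on e a X) w p1"
    by (rule I(3)[OF home[OF a(1)] _ a(2)]) (use sim in auto)
  moreover have "e ` (hvars p1 - X) \<subseteq> M"
    using e(1) p1v by auto
  ultimately obtain c where c: "c ` X \<subseteq> M" "sat U (override_on e c X) w p2"
    using tv_weakeningD[OF tv p1F X _ a(1) _ p2(1)] by blast
  have cU: "c ` X \<subseteq> home U"
    using c(1) M by blast
  have "sat U (override_on v c X) w p'"
  proof (rule ccontr)
    assume "\<not> sat U (override_on v c X) w p'"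
    then have "sat U (override_on v c X) w r"
      by (rule r(4))
    then have "sat U (override_on e c X) w r'"
      by (rule J(3)[unfolded rv, OF home[OF cU], rotated]) (use sim in auto)
    then show False
      using r(5) c(2) by blast
  qed
  then show "\<exists>a. a ` X \<subseteq> Ccl L U M \<and> sat U (override_on v a X) w p'"
    using c(1) subset_Ccl[OF M] by blast
qed

text \<open>Finitely many requirements are packed into one formula and one weakening, so that a
  single witness meets all of them.\<close>

lemma finite_conjunction_weakening:
  assumes "finite A" "\<And>p p'. (p, p') \<in> A \<Longrightarrow> p \<in> forms c L \<and> weakening p p' \<and> hvars p \<subseteq> V"
  shows "\<exists>q q'. q \<in> forms c L \<and> weakening q q' \<and> hvars q \<subseteq> V \<and>
    (\<forall>v w. (\<forall>(p, p')\<in>A. sat U v w p) \<longrightarrow> sat U v w q) \<and>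
    (\<forall>v w. sat U v w q' \<longrightarrow> (\<forall>(p, p')\<in>A. sat U v w p'))"
  using assms
proof (induction A rule: finite_induct)
  case empty
  \<comment> \<open>The empty conjunction. Atoms need a nonempty list of terms, and membership in
    the whole space, which is compact and open, is its own weakening.\<close>
  let ?q = "SIn [SVar 0] (topspace (spow 1)) :: ('f, 'r, 'g, 's) form"
  have cs: "compact_space (spow 1 :: (nat \<Rightarrow> 's) topology)"
    by (rule compact_space_spow[OF compact_S])
  then have "?q \<in> forms c L"
    by (simp add: compact_space_def del: topspace_product_topology)
  moreover have "weakening ?q ?q"
    using compact_nbhd_topspace[OF cs] by (intro weakening.SIn) simp
  moreover have "sat U v w ?q" for v w
    using tuple_in_topspace[of "[w 0]"] by (simp del: topspace_product_topology)
  ultimately show ?case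
    by (intro exI[of _ ?q]) auto
next
  case (insert x A)
  obtain p p' where x: "x = (p, p')"
    by (cases x)
  have "\<exists>q q'. q \<in> forms c L \<and> weakening q q' \<and> hvars q \<subseteq> V \<and>
    (\<forall>v w. (\<forall>(p, p')\<in>A. sat U v w p) \<longrightarrow> sat U v w q) \<and>
    (\<forall>v w. sat U v w q' \<longrightarrow> (\<forall>(p, p')\<in>A. sat U v w p'))"
    using insert.prems by (intro insert.IH) auto
  then obtain q q' where q: "q \<in> forms c L" "weakening q q'" "hvars q \<subseteq> V"
    "\<forall>v w. (\<forall>(p, p')\<in>A. sat U v w p) \<longrightarrow> sat U v w q"
    "\<forall>v w. sat U v w q' \<longrightarrow> (\<forall>(p, p')\<in>A. sat U v w p')"
    by blast
  have p: "p \<in> forms c L" "weakening p p'" "hvars p \<subseteq> V"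
    using insert.prems x by auto
  have "Conj p q \<in> forms c L" "weakening (Conj p q) (Conj p' q')" "hvars (Conj p q) \<subseteq> V"
    using p q by (auto intro: weakening.Conj)
  moreover have "\<forall>v w. (\<forall>(p, p')\<in>insert x A. sat U v w p) \<longrightarrow> sat U v w (Conj p q)"
    using q(4) by (simp add: x)
  moreover have "\<forall>v w. sat U v w (Conj p' q') \<longrightarrow> (\<forall>(p, p')\<in>insert x A. sat U v w p')"
    using q(5) by (simp add: x)
  ultimately show ?case
    by blast
qed

text \<open>For finitely many terms, the condition that y and f(x) give them equal values is
  continuous and is realized by f(x). A witness in Ccl M for a weakening, moved into M by
  \<open>sim_uniform\<close>, shows that f(x) is approximated by M.\<close>

lemma hclosed_Ccl:
  assumes M: "M \<subseteq> home U" and tv: "tv_weakening U (forms True L) (Ccl L U M)"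
  shows "hclosed L U (Ccl L U M)"
  unfolding hclosed_def
proof (intro allI impI, elim conjE)
  fix f n xs
  assume f: "hfun_arity L f = Some n" "length xs = n" "set xs \<subseteq> Ccl L U M"
  define s where "s = HApp f (map HVar [0..<n])"
  define v where "v = (\<lambda>i. xs ! i)"
  let ?a = "hfun U f xs" and ?w = "\<lambda>_ :: nat. undefined :: 's"
  have ev: "heval U (v(n := b)) s = ?a" for b
    unfolding s_def by (rule heval_HApp_vars) (auto simp: f(2) v_def)
  have vM: "v i \<in> Ccl L U M" if "i < n" for i
    using f that by (auto simp: v_def)
  have "set xs \<subseteq> home U"
    using f(3) Ccl_subset_home[of L U M] by simp
  then have home: "?a \<in> home U"
    using standard f(1,2) unfolding standard_structure_def hclosed_def by simp
  have s: "wf_hterm L s" "hvars_hterm s \<subseteq> {..<Suc n}"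
    using f(1) by (auto simp: s_def)
  have "\<exists>b\<in>M. \<forall>(\<tau>, D)\<in>I. sim U \<tau> D ?a b" if I: "finite I" "I \<subseteq> sim_indices L" for I
  proof -
    \<comment> \<open>Equality of values is membership in \<open>pairs Id\<close>, which is compact
      and has \<open>pairs D\<close> as a neighbourhood. Arguments occupy the variables below
      \<open>n\<close> and the candidate variable \<open>n\<close>, hence the shift by
      \<open>Suc n\<close>.\<close>
    define A :: "(('f, 'r, 'g, 's) form \<times> ('f, 'r, 'g, 's) form) set" where
      "A = (\<lambda>(t, D). (close_form (Suc n) s (HVar n) t (pairs Id),
          close_form (Suc n) s (HVar n) t (pairs D))) `
        (\<Union>(\<tau>, D)\<in>I. (\<lambda>t. (t, D)) ` set \<tau>)"
    have fin: "finite A"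
      unfolding A_def using I(1) by (intro finite_imageI finite_UN_I) (auto split: prod.split)
    have elem: "p \<in> forms True L \<and> weakening p p' \<and> hvars p \<subseteq> {..n}" if "(p, p') \<in> A" for p p'
    proof -
      obtain \<tau> D t where t: "(\<tau>, D) \<in> I" "t \<in> set \<tau>"
        "p = close_form (Suc n) s (HVar n) t (pairs Id)"
        "p' = close_form (Suc n) s (HVar n) t (pairs D)"
        using \<open>(p, p') \<in> A\<close> by (auto simp: A_def)
      then have "wf_sterm L t" "compact_nbhd euclidean D Id"
        using I(2) by (auto simp: sim_indices_def)
      then have "p \<in> forms True L" "weakening p p'"
        unfolding t(3,4) using s(1)
        by (auto intro!: close_form_in_forms weakening_close_form compact_nbhd_image_tuple2
            compactin_image_tuple2 compact_Id[OF compact_S])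
      moreover have "hvars p \<subseteq> {..n}"
        using hvars_close_form[of "Suc n" s "HVar n" t "pairs Id"] s(2) unfolding t(3)
        by fastforce
      ultimately show ?thesis
        by blast
    qed
    obtain q q' where q: "q \<in> forms True L" "weakening q q'" "hvars q \<subseteq> {..n}"
      "\<And>v w. (\<forall>(p, p')\<in>A. sat U v w p) \<Longrightarrow> sat U v w q"
      "\<And>v w. sat U v w q' \<Longrightarrow> (\<forall>(p, p')\<in>A. sat U v w p')"
      using finite_conjunction_weakening[OF fin elem] by metis
    obtain q1 where q1: "weakening q q1" "weakening q1 q'"
      using weakening_interpolate[OF compact_S q(2,1)] by blast
    have q1F: "q1 \<in> forms True L" and q1v: "hvars q1 = hvars q"
      using weakening_in_forms[OF q1(1) q(1)] weakening_hvars[OF q1(1)] by auto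
    have sat_close: "sat U (v(n := b)) w (close_form (Suc n) s (HVar n) t (pairs D)) \<longleftrightarrow>
        sim U [t] D ?a b" if "(\<tau>, D') \<in> I" "t \<in> set \<tau>" for \<tau> D D' t b w
    proof -
      have "svars_sterm t = {}"
        using that I(2) by (auto simp: sim_indices_def)
      then have "sat U (v(n := b)) w (close_form (Suc n) s (HVar n) t (pairs D)) \<longleftrightarrow>
          sim U [t] D (heval U (v(n := b)) s) (heval U (v(n := b)) (HVar n))"
        using s(2) home by (intro sat_close_form) auto
      then show ?thesis
        unfolding ev by simp
    qed
    have "\<forall>(p, p')\<in>A. sat U (v(n := ?a)) ?w p"
    proof -
      have "sim U [t] Id ?a ?a" for t :: "('f, 'g, 's) sterm"
        by (simp add: sim_def)
      then show ?thesis
        using sat_close by (auto simp: A_def)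
    qed
    then have "sat U (override_on v (\<lambda>_. ?a) {n}) ?w q"
      using q(4) by (simp add: override_on_singleton)
    moreover have "v ` (hvars q - {n}) \<subseteq> Ccl L U M"
    proof (rule image_subsetI)
      fix i assume "i \<in> hvars q - {n}"
      then have "i < n"
        using q(3) by fastforce
      then show "v i \<in> Ccl L U M"
        by (rule vM)
    qed
    moreover have "(\<lambda>_. ?a) ` {n} \<subseteq> home U"
      using home by auto
    ultimately have "\<exists>y. y ` {n} \<subseteq> Ccl L U M \<and> sat U (override_on v y {n}) ?w q1"
      by (intro tv_weakeningD[OF tv q(1), where a = "\<lambda>_. ?a"]) (auto intro: q1(1))
    \<comment> \<open>This witness lies only in Ccl M, while \<open>Ccl\<close> demands
      approximation by elements of M; the gap from \<open>q1\<close> to \<open>q'\<close> pays for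
      replacing it.\<close>
    then obtain y where y: "y \<in> Ccl L U M" "sat U (v(n := y)) ?w q1"
      by (auto simp: override_on_singleton)
    obtain J where J: "finite J" "J \<subseteq> sim_indices L"
      "\<And>u u' w. u ` hvars q1 \<subseteq> home U \<Longrightarrow> u' ` hvars q1 \<subseteq> home U \<Longrightarrow>
        (\<And>i \<tau> D. i \<in> hvars q1 \<Longrightarrow> (\<tau>, D) \<in> J \<Longrightarrow> sim U \<tau> D (u i) (u' i)) \<Longrightarrow>
        sat U u w q1 \<Longrightarrow> sat U u' w q'"
      using sim_uniform[OF q1F q1(2)] by metis
    obtain b where b: "b \<in> M" "\<And>\<tau> D. (\<tau>, D) \<in> J \<Longrightarrow> sim U \<tau> D y b"
      using Ccl_approx[OF y(1) J(1,2)] by metis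
    have vhome: "(v(n := z)) ` hvars q1 \<subseteq> home U" if "z \<in> home U" for z
    proof -
      have "(v(n := z)) i \<in> home U" if "i \<le> n" for i
        using vM[of i] Ccl_subset_home[of L U M] \<open>z \<in> home U\<close> that by (cases "i = n") auto
      then show ?thesis
        using q(3) q1v by blast
    qed
    have "y \<in> home U" "b \<in> home U"
      using y(1) Ccl_subset_home[of L U M] b(1) M by auto
    then have "sat U (v(n := b)) ?w q'"
    proof (intro J(3)[OF vhome vhome _ y(2)])
      show "sim U \<tau> D ((v(n := y)) i) ((v(n := b)) i)" if "(\<tau>, D) \<in> J" for i \<tau> D
        using that b(2) J(2) sim_refl[of \<tau> D L U "v i"] by auto
    qed
    then have A': "\<forall>(p, p')\<in>A. sat U (v(n := b)) ?w p'"
      by (rule q(5))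
    have "sim U \<tau> D ?a b" if tD: "(\<tau>, D) \<in> I" for \<tau> D
    proof -
      have "sim U [t] D ?a b" if t: "t \<in> set \<tau>" for t
      proof -
        have "(close_form (Suc n) s (HVar n) t (pairs Id),
            close_form (Suc n) s (HVar n) t (pairs D)) \<in> A"
          using tD t by (force simp: A_def)
        then show ?thesis
          using A' sat_close[OF tD t] by blast
      qed
      then show ?thesis
        by (simp add: sim_def)
    qed
    then show ?thesis
      using b(1) by blast
  qed
  then show "?a \<in> Ccl L U M"
    using home by (simp add: Ccl_def)
qed

section \<open>The equivalences for p-models and c-models\<close>

lemma p_model_iff_tv_weakening:
  assumes H: "H \<subseteq> positive_forms L" "p_dense TYPE('u) L (positive_theory L U) H"
    and M: "M \<subseteq> home U"
  shows "p_model L U M \<longleftrightarrow> tv_weakening U H M"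
    and "tv_weakening U H M \<longleftrightarrow> tv_negation U H M"
proof -
  note tv = tv_conditions_dense[OF H(1)[unfolded positive_forms_eq]
      H(2)[unfolded p_dense_def positive_forms_eq] M]
  show "tv_weakening U H M \<longleftrightarrow> tv_negation U H M"
    using tv(1,2) by blast
  have "p_model L U M \<Longrightarrow> tv_weakening U (forms False L) M"
    unfolding p_model_def positive_forms_eq by (rule tv_weakening_if_submodel[OF compact_S])
  moreover have "tv_weakening U (forms False L) M \<Longrightarrow> p_model L U M"
    unfolding p_model_def positive_forms_eq
    using submodel_if_tv_negation[OF tv(3) M] hclosed_if_tv_negation[OF tv(3) M standard] by blast
  ultimately show "p_model L U M \<longleftrightarrow> tv_weakening U H M"
    using tv(1) by blast
qed

lemma c_model_iff_tv_weakening: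
  assumes H: "H \<subseteq> continuous_forms L" "c_dense TYPE('u) L (positive_theory L U) H"
    and M: "M \<subseteq> home U"
  shows "c_model L U (Ccl L U M) \<longleftrightarrow> tv_weakening U H M"
    and "tv_weakening U H M \<longleftrightarrow> tv_negation U H M"
    and "hclosed L U M \<Longrightarrow> c_model L U M \<longleftrightarrow> tv_weakening U H M"
proof -
  note dense = tv_conditions_dense[OF H(1)[unfolded continuous_forms_eq]
      H(2)[unfolded c_dense_def continuous_forms_eq]]
  note tv = dense[OF M] and tvC = dense[OF Ccl_subset_home[of L U M]]
  show "tv_weakening U H M \<longleftrightarrow> tv_negation U H M"
    using tv(1,2) by blast
  have model_imp: "c_model L U A \<Longrightarrow> tv_weakening U (forms True L) A" for A
    unfolding c_model_def continuous_forms_eq by (rule tv_weakening_if_submodel[OF compact_S])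
  have "tv_weakening U (forms True L) M \<Longrightarrow> hclosed L U M \<Longrightarrow> c_model L U M"
    unfolding c_model_def continuous_forms_eq by (rule submodel_if_tv_negation[OF tv(3) M])
  then show "hclosed L U M \<Longrightarrow> c_model L U M \<longleftrightarrow> tv_weakening U H M"
    using tv(1) model_imp by blast
  have "tv_weakening U (forms True L) M \<longleftrightarrow> tv_weakening U (forms True L) (Ccl L U M)"
    using tv_weakening_if_tv_weakening_Ccl[OF M] tv_weakening_Ccl_if_tv_weakening[OF M] by blast
  moreover have "tv_weakening U (forms True L) (Ccl L U M) \<Longrightarrow> c_model L U (Ccl L U M)"
    unfolding c_model_def continuous_forms_eq
    by (rule submodel_if_tv_negation[OF tvC(3) Ccl_subset_home hclosed_Ccl[OF M]])
  ultimately show "c_model L U (Ccl L U M) \<longleftrightarrow> tv_weakening U H M"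
    using tv(1) model_imp by blast
qed

end

theorem theorem8p1:
  fixes L :: "('f, 'r, 'g) lang"
    and U :: "('f, 'r, 'g, 's::t2_space, 'u) struct"
    and T :: "('f, 'r, 'g, 's) form set"
    and M :: "'u set"
    and \<H> :: "('f, 'r, 'g, 's) form set"
  assumes "compact (UNIV :: 's set)"
    and "standard_structure L U"
    and "infinite (home U)"
    and "p_saturated L U"
    and "T = positive_theory L U"
    and "M \<subseteq> home U"
  shows
    "(\<H> \<subseteq> positive_forms L \<and> p_dense TYPE('u) L T \<H> \<longrightarrow>
        (p_model L U M \<longleftrightarrow> tv_weakening U \<H> M) \<and>
        (tv_weakening U \<H> M \<longleftrightarrow> tv_negation U \<H> M)) \<and>
     (\<H> \<subseteq> continuous_forms L \<and> c_dense TYPE('u) L T \<H> \<longrightarrow>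
        (c_model L U (Ccl L U M) \<longleftrightarrow> tv_weakening U \<H> M) \<and>
        (tv_weakening U \<H> M \<longleftrightarrow> tv_negation U \<H> M) \<and>
        (hclosed L U M \<longrightarrow>
           (c_model L U M \<longleftrightarrow> c_model L U (Ccl L U M)) \<and>
           (c_model L U M \<longleftrightarrow> tv_weakening U \<H> M) \<and>
           (c_model L U M \<longleftrightarrow> tv_negation U \<H> M)))"
proof -
  interpret saturated_structure L U
    by unfold_locales (use assms in auto)
  show ?thesis
    using p_model_iff_tv_weakening[of \<H> M] c_model_iff_tv_weakening[of \<H> M] assms(5,6) by metis
qed

end
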